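(* Let $\mathbf{K}$ be an algebraically closed field of arbitrary characteristic, complete with respect to a non-Archimedean absolute value. Let $X\subset \mathbb{P}^N(\mathbf{K})$ be a projective subvariety of dimension $n\ge 1$ over $\mathbf{K}$. Let $D_1,\dots,D_q$ be hypersurfaces in $\mathbb{P}^N(\mathbf{K})$ in general position with $X$. Let $f:\mathbf{K}\to X$ be a non-constant analytic map whose image is not completely contained in any of the hypersurfaces $D_1,\dots,D_q$. Then, for any positive real number $r$, $$\sum_{j=1}^q\frac{m_f(r,D_j)}{\deg D_j}\le n\,T_f(r)+O(1),$$ where $O(1)$ is a constant independent of $r$.
   Context: For an entire function $g(z)=\sum_{j\ge0}a_jz^j$ on $\mathbf{K}$ (a power series with coefficients in $\mathbf{K}$ converging on all of $\mathbf{K}$) and real $r\ge0$, set $|g|_r=\sup_j|a_j|r^j$. A non-constant analytic curve (analytic map) $f:\mathbf{K}\to\mathbb{P}^N(\mathbf{K})$ is given by a reduced representation $\tilde f=(f_0,\dots,f_N)$, where $f_0,\dots,f_N$ are entire functions on $\mathbf{K}$ without common zeros, at least one of which is non-constant. An analytic map $f:\mathbf{K}\to X$ is an analytic curve in $\mathbb{P}^N(\mathbf{K})$ whose image lies in $X$. Fix a reduced representation of $f$ and set $\|f\|_r=\max\{|f_0|_r,\dots,|f_N|_r\}$. The Nevanlinna characteristic function is $T_f(r)=\log\|f\|_r$ (independent, up to an additive constant, of the choice of reduced representation). For a hypersurface $D\subset\mathbb{P}^N(\mathbf{K})$ of degree $d$ defined by a homogeneous form $Q$ of degree $d$ in $N+1$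 variables with coefficients in $\mathbf{K}$, put $Q\circ f=Q(f_0,\dots,f_N)$, an entire function on $\mathbf{K}$. If $Q\circ f\not\equiv0$, the proximity function is $m_f(r,D)=\log\dfrac{\|f\|_r^d}{|Q\circ f|_r}$ (independent, up to an additive constant, of the choice of defining form $Q$). The subvariety $X$ is not necessarily smooth. A collection of $q\ge n+1$ hypersurfaces $D_1,\dots,D_q$ in $\mathbb{P}^N(\mathbf{K})$, with defining forms $Q_1,\dots,Q_q$, is said to be in general position with the $n$-dimensional projective subvariety $X$ if for every subset $\{i_0,\dots,i_n\}$ of $\{1,\dots,q\}$ of cardinality $n+1$ one has $\{x\in X: Q_{i_j}(x)=0,\ j=0,\dots,n\}=\emptyset$.
   Formalization: The O(1) is uniform in r only on r ≥ r0 for each fixed r0 > 0, with the constant depending on r0; a single constant for all positive r is impossible, e.g. for f = (1:z) in P^1 with D_1 = {x_1 = 0}, D_2 = {x_0 = 0} as r → 0. *)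

theory Defs
  imports
    "HOL-Analysis.Analysis"
    "HOL-Library.Poly_Mapping"
    "HOL-Library.Extended_Nat"
    "HOL-Computational_Algebra.Computational_Algebra"
begin

section \<open>Non-Archimedean fields\<close>

definition nonarch_abs :: "('a::field \<Rightarrow> real) \<Rightarrow> bool" where
  "nonarch_abs v \<longleftrightarrow>
     (\<forall>x. 0 \<le> v x) \<and> (\<forall>x. v x = 0 \<longleftrightarrow> x = 0) \<and>
     (\<forall>x y. v (x * y) = v x * v y) \<and>
     (\<forall>x y. v (x + y) \<le> max (v x) (v y))"

definition abs_complete :: "('a::field \<Rightarrow> real) \<Rightarrow> bool" where
  "abs_complete v \<longleftrightarrow> Metric_space.mcomplete UNIV (\<lambda>x y. v (x - y))"

definition abs_topology :: "('a::field \<Rightarrow> real) \<Rightarrow> 'a topology" where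
  "abs_topology v = Metric_space.mtopology UNIV (\<lambda>x y. v (x - y))"


section \<open>Entire functions\<close>

text \<open>An entire function is given by its power series. Its values are taken with respect to
  the absolute value \<open>v\<close>, so \<open>eval_fps\<close>, which needs a real normed algebra, is not available.\<close>

definition fps_sums_at :: "('a::field \<Rightarrow> real) \<Rightarrow> 'a fps \<Rightarrow> 'a \<Rightarrow> 'a \<Rightarrow> bool" where
  "fps_sums_at v g z s \<longleftrightarrow>
     limitin (abs_topology v) (\<lambda>m. \<Sum>j<m. fps_nth g j * z ^ j) s sequentially"

definition entire :: "('a::field \<Rightarrow> real) \<Rightarrow> 'a fps \<Rightarrow> bool" where
  "entire v g \<longleftrightarrow> (\<forall>z. \<exists>s. fps_sums_at v g z s)"

definition fps_value :: "('a::field \<Rightarrow> real) \<Rightarrow> 'a fps \<Rightarrow> 'a \<Rightarrow> 'a" where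
  "fps_value v g z = (THE s. fps_sums_at v g z s)"

definition gauss_norm :: "('a::field \<Rightarrow> real) \<Rightarrow> real \<Rightarrow> 'a fps \<Rightarrow> real" where
  "gauss_norm v r g = (SUP j. v (fps_nth g j) * r ^ j)"


section \<open>Homogeneous forms and projective space\<close>

text \<open>Polynomials in variables indexed by the finite type \<open>'N\<close>; for projective space of
  dimension \<open>N\<close> this index type has \<open>N + 1\<close> elements.\<close>

type_synonym ('a, 'N) mpoly = "('N \<Rightarrow>\<^sub>0 nat) \<Rightarrow>\<^sub>0 'a"

definition mpoly_subst ::
    "('a::zero \<Rightarrow> 'b::comm_semiring_1) \<Rightarrow> ('a, 'N::finite) mpoly \<Rightarrow> 'b ^ 'N \<Rightarrow> 'b" where
  "mpoly_subst h P x =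
     (\<Sum>m\<in>Poly_Mapping.keys P. h (Poly_Mapping.lookup P m) *
        (\<Prod>i\<in>UNIV. (x $ i) ^ Poly_Mapping.lookup m i))"

definition is_form :: "nat \<Rightarrow> ('a::zero, 'N::finite) mpoly \<Rightarrow> bool" where
  "is_form d P \<longleftrightarrow>
     (\<forall>m\<in>Poly_Mapping.keys P. (\<Sum>i\<in>UNIV. Poly_Mapping.lookup m i) = d)"

text \<open>A point of projective space is the set of all its homogeneous coordinate vectors.\<close>

type_synonym ('a, 'N) ppoint = "('a ^ 'N) set"

definition proj_point :: "'a::field ^ 'N::finite \<Rightarrow> ('a, 'N) ppoint" where
  "proj_point x = {c *s x | c. c \<noteq> 0}"

definition proj_space :: "('a::field, 'N::finite) ppoint set" where
  "proj_space = proj_point ` {x. x \<noteq> 0}"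

definition vanishes_at :: "('a::field, 'N::finite) mpoly \<Rightarrow> ('a, 'N) ppoint \<Rightarrow> bool" where
  "vanishes_at P p \<longleftrightarrow> (\<forall>x\<in>p. mpoly_subst (\<lambda>c. c) P x = 0)"

definition proj_zeros :: "('a::field, 'N::finite) mpoly set \<Rightarrow> ('a, 'N) ppoint set" where
  "proj_zeros S = {p \<in> proj_space. \<forall>P\<in>S. vanishes_at P p}"

definition proj_closed :: "('a::field, 'N::finite) ppoint set \<Rightarrow> bool" where
  "proj_closed Z \<longleftrightarrow> (\<exists>S. (\<forall>P\<in>S. \<exists>d. is_form d P) \<and> Z = proj_zeros S)"

definition projective_variety :: "('a::field, 'N::finite) ppoint set \<Rightarrow> bool" where
  "projective_variety Z \<longleftrightarrow>
     proj_closed Z \<and> Z \<noteq> {} \<and>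
     (\<forall>A B. proj_closed A \<longrightarrow> proj_closed B \<longrightarrow> Z \<subseteq> A \<union> B \<longrightarrow> Z \<subseteq> A \<or> Z \<subseteq> B)"

definition proj_dim :: "('a::field, 'N::finite) ppoint set \<Rightarrow> enat" where
  "proj_dim X = Sup {enat m | m.
     \<exists>Z :: nat \<Rightarrow> ('a, 'N) ppoint set.
       (\<forall>i\<le>m. projective_variety (Z i) \<and> Z i \<subseteq> X) \<and> (\<forall>i<m. Z i \<subset> Z (Suc i))}"


section \<open>Hypersurfaces\<close>

text \<open>A hypersurface is represented by a defining form, which need not be square-free.\<close>

definition hypersurface_form :: "nat \<Rightarrow> ('a::field, 'N::finite) mpoly \<Rightarrow> bool" where
  "hypersurface_form d Q \<longleftrightarrow> is_form d Q \<and> Q \<noteq> 0 \<and> 1 \<le> d"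

definition hypersurface :: "('a::field, 'N::finite) mpoly \<Rightarrow> ('a, 'N) ppoint set" where
  "hypersurface Q = proj_zeros {Q}"

definition in_general_position ::
    "nat \<Rightarrow> ('a::field, 'N::finite) ppoint set \<Rightarrow> nat \<Rightarrow> (nat \<Rightarrow> ('a, 'N) mpoly) \<Rightarrow> bool" where
  "in_general_position n X q Q \<longleftrightarrow>
     n + 1 \<le> q \<and>
     (\<forall>I. I \<subseteq> {1..q} \<longrightarrow> card I = n + 1 \<longrightarrow> {x \<in> X. \<forall>i\<in>I. vanishes_at (Q i) x} = {})"


section \<open>Analytic curves and Nevanlinna functions\<close>

definition reduced_representation ::
    "('a::field \<Rightarrow> real) \<Rightarrow> 'a fps ^ 'N::finite \<Rightarrow> ('a \<Rightarrow> ('a, 'N) ppoint) \<Rightarrow> bool" where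
  "reduced_representation v F f \<longleftrightarrow>
     (\<forall>i. entire v (F $ i)) \<and>
     (\<forall>z. \<exists>i. fps_value v (F $ i) z \<noteq> 0) \<and>
     (\<forall>z. f z = proj_point (\<chi> i. fps_value v (F $ i) z))"

text \<open>Since entire functions without zeros are constant, having a non-constant component in
  one reduced representation is the same as \<open>f\<close> being non-constant.\<close>

definition nonconstant_representation :: "'a::field fps ^ 'N::finite \<Rightarrow> bool" where
  "nonconstant_representation F \<longleftrightarrow> (\<exists>i. \<forall>c. F $ i \<noteq> fps_const c)"

definition curve_norm :: "('a::field \<Rightarrow> real) \<Rightarrow> real \<Rightarrow> 'a fps ^ 'N::finite \<Rightarrow> real" where
  "curve_norm v r F = Max (range (\<lambda>i. gauss_norm v r (F $ i)))"

definition characteristic :: "('a::field \<Rightarrow> real) \<Rightarrow> 'a fps ^ 'N::finite \<Rightarrow> real \<Rightarrow> real" where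
  "characteristic v F r = ln (curve_norm v r F)"

definition form_comp :: "('a::field, 'N::finite) mpoly \<Rightarrow> 'a fps ^ 'N \<Rightarrow> 'a fps" where
  "form_comp Q F = mpoly_subst fps_const Q F"

text \<open>If \<open>Q \<circ> f\<close> vanishes at \<open>0\<close>, then the proximity function tends to infinity as \<open>r\<close> tends
  to \<open>0\<close>, whereas the characteristic function stays bounded. Estimates between the two that are
  uniform in \<open>r\<close> therefore need \<open>r\<close> to be bounded away from \<open>0\<close>.\<close>

definition proximity ::
    "('a::field \<Rightarrow> real) \<Rightarrow> 'a fps ^ 'N::finite \<Rightarrow> nat \<Rightarrow> ('a, 'N) mpoly \<Rightarrow> real \<Rightarrow> real" where
  "proximity v F d Q r = ln (curve_norm v r F ^ d / gauss_norm v r (form_comp Q F))"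

end

theory Submission
  imports Defs
begin

text \<open>If finitely many \<open>Q\<^sub>i\<close>, \<open>i \<in> I\<close>, have no common zero on \<open>X\<close>, then by the Nullstellensatz some
  power \<open>x\<^sub>k\<^sup>K\<close> of each coordinate lies in the ideal generated by these \<open>Q\<^sub>i\<close> and the forms vanishing
  on \<open>X\<close>. Composing with the curve kills the latter, and comparing Gauss norms, which are
  multiplicative and ultrametric, gives \<open>|Q\<^sub>i \<circ> f|\<^sub>r \<ge> c \<parallel>f\<parallel>\<^sub>r\<^sup>d\<close> for some \<open>i \<in> I\<close>, with \<open>d = deg Q\<^sub>i\<close> and \<open>c > 0\<close>
  independent of \<open>r\<close>. By general position, for each \<open>r\<close> all but at most \<open>n\<close> of the proximity functions
  are therefore bounded, and each of the remaining ones, divided by the degree, is at most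
  \<open>T\<^sub>f(r) + O(1)\<close>.\<close>

section \<open>Homomorphisms into an algebraically closed field\<close>

text \<open>If no power of b lies in the ideal generated by T, the Nullstellensatz asks for a point
  of affine space where T vanishes and b does not. Such a point is a homomorphism from the
  polynomial ring to the field that fixes constants, kills a prime P containing T, and does not kill
  b. It is built by adjoining the variables one at a time; all computations stay in the polynomial
  ring, modulo P. The cofactors in x_k^K = \<Sum> a_g g need not be homogeneous, and the bound needs
  the exact exponent deg g. Comparing parts of degree K provides it, since only the part of a_g of
  degree K - deg g contributes. \<open>nonarch_abs\<close> admits the trivial absolute value, for
  which radii are not dominated by values v z and no nonzero z is small; entire functions are then
  polynomials. This causes the case distinctions in \<open>entire_terms_null\<close> and
  \<open>entire_eq_zero\<close>.\<close>

definition subring_closed :: "'r::comm_ring_1 set \<Rightarrow> bool" where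
  "subring_closed A \<longleftrightarrow> 0 \<in> A \<and> 1 \<in> A \<and> (\<forall>x\<in>A. - x \<in> A) \<and>
     (\<forall>x\<in>A. \<forall>y\<in>A. x + y \<in> A \<and> x * y \<in> A)"

definition poly_over :: "'r::comm_ring_1 set \<Rightarrow> 'r poly \<Rightarrow> bool" where
  "poly_over A f \<longleftrightarrow> (\<forall>i. coeff f i \<in> A)"

definition adjoin :: "'r::comm_ring_1 set \<Rightarrow> 'r \<Rightarrow> 'r set" where
  "adjoin A x = {poly f x | f. poly_over A f}"

lemma subring_sum: "subring_closed A \<Longrightarrow> (\<And>i. i \<in> I \<Longrightarrow> g i \<in> A) \<Longrightarrow> sum g I \<in> A"
  by (induction I rule: infinite_finite_induct) (auto simp: subring_closed_def)

lemma poly_over_add: "subring_closed A \<Longrightarrow> poly_over A f \<Longrightarrow> poly_over A g \<Longrightarrow> poly_over A (f + g)"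
  by (auto simp: poly_over_def subring_closed_def)

lemma poly_over_minus: "subring_closed A \<Longrightarrow> poly_over A f \<Longrightarrow> poly_over A (- f)"
  by (auto simp: poly_over_def subring_closed_def)

lemma poly_over_diff: "subring_closed A \<Longrightarrow> poly_over A f \<Longrightarrow> poly_over A g \<Longrightarrow> poly_over A (f - g)"
  using poly_over_add[of A f "- g"] poly_over_minus[of A g] by simp

lemma poly_over_mult: "subring_closed A \<Longrightarrow> poly_over A f \<Longrightarrow> poly_over A g \<Longrightarrow> poly_over A (f * g)"
  unfolding poly_over_def coeff_mult
  by (intro allI subring_sum) (auto simp: subring_closed_def)

lemma poly_over_const: "subring_closed A \<Longrightarrow> a \<in> A \<Longrightarrow> poly_over A [:a:]"
  by (auto simp: poly_over_def subring_closed_def coeff_pCons split: nat.splits)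

lemma poly_over_monom: "subring_closed A \<Longrightarrow> a \<in> A \<Longrightarrow> poly_over A (monom a k)"
  by (auto simp: poly_over_def subring_closed_def)

lemma poly_over_smult: "subring_closed A \<Longrightarrow> a \<in> A \<Longrightarrow> poly_over A f \<Longrightarrow> poly_over A (smult a f)"
  by (auto simp: poly_over_def subring_closed_def)

lemma subring_power: "subring_closed A \<Longrightarrow> a \<in> A \<Longrightarrow> a ^ n \<in> A"
  by (induction n) (auto simp: subring_closed_def)

lemma subset_adjoin:
  assumes "subring_closed A"
  shows "A \<subseteq> adjoin A x"
proof
  fix a assume "a \<in> A"
  then have "poly_over A [:a:]" "a = poly [:a:] x"
    using assms by (auto simp: poly_over_const)
  then show "a \<in> adjoin A x" unfolding adjoin_def by blast
qed

lemma mem_adjoin: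
  assumes "subring_closed A"
  shows "x \<in> adjoin A x"
proof -
  have "poly_over A (monom 1 1)" "x = poly (monom 1 1) x"
    using assms by (auto simp: poly_monom subring_closed_def intro!: poly_over_monom)
  then show ?thesis unfolding adjoin_def by blast
qed

lemma subring_adjoin:
  assumes A: "subring_closed A"
  shows "subring_closed (adjoin A x)"
  unfolding subring_closed_def
proof (intro conjI ballI)
  show "0 \<in> adjoin A x" "1 \<in> adjoin A x"
    using subset_adjoin[OF A] A by (auto simp: subring_closed_def)
next
  fix y assume "y \<in> adjoin A x"
  then obtain f where "poly_over A f" "y = poly f x" by (auto simp: adjoin_def)
  then show "- y \<in> adjoin A x"
    unfolding adjoin_def using poly_over_minus[OF A] by (metis (mono_tags, lifting) mem_Collect_eq poly_minus)
next
  fix y z assume "y \<in> adjoin A x" "z \<in> adjoin A x"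
  then obtain f g where fg: "poly_over A f" "y = poly f x" "poly_over A g" "z = poly g x"
    by (auto simp: adjoin_def)
  show "y + z \<in> adjoin A x"
    unfolding adjoin_def using poly_over_add[OF A fg(1,3)] fg by (auto intro!: exI[of _ "f + g"])
  show "y * z \<in> adjoin A x"
    unfolding adjoin_def using poly_over_mult[OF A fg(1,3)] fg by (auto intro!: exI[of _ "f * g"])
qed

text \<open>The leading coefficient of h need not be invertible, so each division step first
  multiplies by it; quotient and remainder then stay over A. Products may lose degree in a ring with
  zero divisors, hence only inequalities. The bound on the degree of g later places a quotient below
  the minimal degree of a relation.\<close>

lemma pseudo_division_over:
  fixes h :: "'r::comm_ring_1 poly"
  assumes A: "subring_closed A" and h: "poly_over A h" "0 < degree h"
  shows "poly_over A f \<Longrightarrow> \<exists>s g r. smult (lead_coeff h ^ s) f = h * g + r \<and> degree r < degree h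
           \<and> degree g \<le> degree f - degree h \<and> poly_over A g \<and> poly_over A r"
proof (induction "degree f" arbitrary: f rule: less_induct)
  case less
  show ?case
  proof (cases "degree f < degree h")
    case True
    have "poly_over A 0" using A by (auto simp: poly_over_def subring_closed_def)
    with True less.prems show ?thesis
      by (intro exI[of _ 0] exI[of _ "0::'r poly"] exI[of _ f]) auto
  next
    case False
    define k where "k = degree f - degree h"
    define m where "m = monom (lead_coeff f) k"
    define f' where "f' = smult (lead_coeff h) f - m * h"
    have lc: "lead_coeff h \<in> A" "lead_coeff f \<in> A"
      using h less.prems by (auto simp: poly_over_def)
    have m: "poly_over A m" unfolding m_def using A lc by (intro poly_over_monom)
    have f': "poly_over A f'" unfolding f'_def
      using A lc m h less.prems by (intro poly_over_diff poly_over_smult poly_over_mult) auto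
    have dm: "degree m \<le> k" unfolding m_def by (rule degree_monom_le)
    have "degree (m * h) \<le> degree f"
      using degree_mult_le[of m h] dm False by (simp add: k_def)
    then have df': "degree f' \<le> degree f"
      unfolding f'_def by (intro degree_diff_le degree_smult_le[THEN order_trans]) auto
    have "coeff (m * h) (degree f) = lead_coeff f * lead_coeff h"
      using False unfolding m_def by (simp add: coeff_monom_mult k_def)
    then have "coeff f' (degree f) = 0" unfolding f'_def by (simp add: mult.commute)
    then have "degree f' < degree f"
      using df' False h(2) by (metis degree_0 le_neq_implies_less leading_coeff_0_iff not_gr_zero)
    from less.hyps[OF this f'] obtain s g r where
      IH: "smult (lead_coeff h ^ s) f' = h * g + r" "degree r < degree h"
        "degree g \<le> degree f' - degree h" "poly_over A g" "poly_over A r" by blast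
    define g' where "g' = g + smult (lead_coeff h ^ s) m"
    have "smult (lead_coeff h ^ Suc s) f = smult (lead_coeff h ^ s) (f' + m * h)"
      unfolding f'_def by (simp add: mult.commute)
    also have "\<dots> = h * g' + r"
      using IH(1) by (simp add: smult_add_right g'_def algebra_simps)
    finally have 1: "smult (lead_coeff h ^ Suc s) f = h * g' + r" .
    have "degree g' \<le> degree f - degree h" unfolding g'_def
      using IH(3) df' dm by (intro degree_add_le degree_smult_le[THEN order_trans]) (auto simp: k_def)
    moreover have "poly_over A g'" unfolding g'_def
      using A IH(4) m lc by (intro poly_over_add poly_over_smult subring_power) auto
    ultimately show ?thesis using 1 IH by blast
  qed
qed

text \<open>For non-constant p, a root of p - 1 is a point where p takes the value 1.\<close>

lemma nonroot_exists:
  fixes p :: "'a::alg_closed_field poly"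
  assumes "p \<noteq> 0"
  shows "\<exists>x. poly p x \<noteq> 0"
proof (cases "degree p = 0")
  case True
  then show ?thesis using assms by (metis degree_eq_zeroE poly_const_conv pCons_eq_0_iff)
next
  case False
  then have "degree (p - 1) > 0"
    by (metis degree_1 degree_add_eq_left diff_add_cancel gr0I degree_diff_le le_numeral_extra(3) le_zero_eq degree_add_le)
  then obtain x where "poly (p - 1) x = 0" using alg_closed_imp_poly_has_root by blast
  then have "poly p x \<noteq> 0" by simp
  then show ?thesis ..
qed

section \<open>Congruences and homomorphisms modulo a prime ideal\<close>

locale prime_ideal_set =
  fixes P :: "'r::comm_ring_1 set"
  assumes zero_mem: "0 \<in> P"
    and add_mem: "x \<in> P \<Longrightarrow> y \<in> P \<Longrightarrow> x + y \<in> P"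
    and mult_mem: "y \<in> P \<Longrightarrow> x * y \<in> P"
    and one_not_mem: "1 \<notin> P"
    and prime: "x * y \<in> P \<Longrightarrow> x \<in> P \<or> y \<in> P"
begin

lemma mult_mem2: "x \<in> P \<Longrightarrow> x * y \<in> P"
  using mult_mem[of x y] by (simp add: mult.commute)

lemma minus_mem: "x \<in> P \<Longrightarrow> - x \<in> P"
  using mult_mem[of x "-1"] by simp

lemma diff_mem: "x \<in> P \<Longrightarrow> y \<in> P \<Longrightarrow> x - y \<in> P"
  using add_mem[of x "- y"] minus_mem[of y] by simp

lemma sum_mem: "(\<And>i. i \<in> I \<Longrightarrow> g i \<in> P) \<Longrightarrow> sum g I \<in> P"
  by (induction I rule: infinite_finite_induct) (auto intro: add_mem zero_mem)

lemma power_not_mem: "x \<notin> P \<Longrightarrow> x ^ n \<notin> P"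
  by (induction n) (auto simp: one_not_mem dest: prime)

lemma mem_cong: "x - y \<in> P \<Longrightarrow> x \<in> P \<longleftrightarrow> y \<in> P"
  using add_mem[of "x - y" y] diff_mem[of x "x - y"] by auto

lemma poly_mem: "poly_over P f \<Longrightarrow> poly f x \<in> P"
  unfolding poly_altdef poly_over_def by (intro sum_mem mult_mem2) auto

text \<open>The representative of f modulo P whose degree and leading coefficient are those of the
  reduction of f over R/P: a leading coefficient that survives here is nonzero modulo P.\<close>

definition strip :: "'r poly \<Rightarrow> 'r poly" where
  "strip f = map_poly (\<lambda>c. if c \<in> P then 0 else c) f"

lemma coeff_strip: "coeff (strip f) i = (if coeff f i \<in> P then 0 else coeff f i)"
  unfolding strip_def by (subst coeff_map_poly) (auto simp: zero_mem)

lemma strip_over: "subring_closed A \<Longrightarrow> poly_over A f \<Longrightarrow> poly_over A (strip f)"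
  by (auto simp: poly_over_def coeff_strip subring_closed_def)

lemma strip_eq_0: "strip f = 0 \<longleftrightarrow> poly_over P f"
  by (auto simp: poly_eq_iff coeff_strip poly_over_def zero_mem)

lemma lead_strip: "strip f \<noteq> 0 \<Longrightarrow> lead_coeff (strip f) \<notin> P"
  by (metis coeff_strip leading_coeff_0_iff)

lemma degree_strip: "degree (strip f) \<le> degree f"
  by (rule degree_le) (simp add: coeff_strip coeff_eq_0)

lemma poly_strip: "poly f x - poly (strip f) x \<in> P"
proof -
  have "poly_over P (f - strip f)"
    by (auto simp: poly_over_def coeff_strip zero_mem)
  from poly_mem[OF this] show ?thesis by simp
qed

text \<open>Encodes a homomorphism to a field from the image of A in R/P, as a total function on R
  that is constrained only on A and kills A \<inter> P.\<close>

definition hom_mod :: "'r set \<Rightarrow> ('r \<Rightarrow> 'a::field) \<Rightarrow> bool" where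
  "hom_mod A \<phi> \<longleftrightarrow> \<phi> 1 = 1 \<and> (\<forall>x\<in>A. \<forall>y\<in>A. \<phi> (x + y) = \<phi> x + \<phi> y \<and> \<phi> (x * y) = \<phi> x * \<phi> y) \<and>
     (\<forall>x\<in>A \<inter> P. \<phi> x = 0)"

context
  fixes A :: "'r set" and \<phi> :: "'r \<Rightarrow> 'a::field"
  assumes A: "subring_closed A" and \<phi>: "hom_mod A \<phi>"
begin

lemma hom_zero: "\<phi> 0 = 0"
  using A \<phi> zero_mem by (auto simp: hom_mod_def subring_closed_def)

lemma hom_sum: "(\<And>i. i \<in> I \<Longrightarrow> g i \<in> A) \<Longrightarrow> \<phi> (sum g I) = (\<Sum>i\<in>I. \<phi> (g i))"
proof (induction I rule: infinite_finite_induct)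
  case (insert i I)
  have "sum g I \<in> A" by (rule subring_sum[OF A]) (simp add: insert)
  with insert \<phi> show ?case by (simp add: hom_mod_def)
qed (auto simp: hom_zero)

lemma hom_power: "a \<in> A \<Longrightarrow> \<phi> (a ^ n) = \<phi> a ^ n"
  using \<phi> subring_power[OF A, of a] by (induction n) (auto simp: hom_mod_def)

lemma map_hom_add:
  "poly_over A f \<Longrightarrow> poly_over A g \<Longrightarrow> map_poly \<phi> (f + g) = map_poly \<phi> f + map_poly \<phi> g"
  using \<phi> by (intro poly_eqI) (auto simp: coeff_map_poly hom_zero poly_over_def hom_mod_def)

lemma map_hom_mult:
  assumes "poly_over A f" "poly_over A g"
  shows "map_poly \<phi> (f * g) = map_poly \<phi> f * map_poly \<phi> g"
proof (intro poly_eqI)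
  fix n
  have *: "coeff f i \<in> A" "coeff g i \<in> A" for i using assms by (auto simp: poly_over_def)
  have "\<phi> (\<Sum>i\<le>n. coeff f i * coeff g (n - i)) = (\<Sum>i\<le>n. \<phi> (coeff f i * coeff g (n - i)))"
    using A * by (intro hom_sum) (auto simp: subring_closed_def)
  then show "coeff (map_poly \<phi> (f * g)) n = coeff (map_poly \<phi> f * map_poly \<phi> g) n"
    using \<phi> * by (simp add: coeff_map_poly hom_zero coeff_mult hom_mod_def)
qed

lemma map_hom_smult:
  assumes "a \<in> A" "poly_over A f"
  shows "map_poly \<phi> (smult a f) = smult (\<phi> a) (map_poly \<phi> f)"
  using assms \<phi> by (intro poly_eqI) (auto simp: coeff_map_poly hom_zero poly_over_def hom_mod_def)

lemma map_hom_zero: "poly_over A f \<Longrightarrow> poly_over P f \<Longrightarrow> map_poly \<phi> f = 0"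
  using \<phi> by (intro poly_eqI) (auto simp: coeff_map_poly hom_zero poly_over_def hom_mod_def)

text \<open>Sending x to \<xi> is well defined once \<xi> satisfies every relation of x modulo P.
  For two polynomials with the same value at x, \<open>W\<close> applied to their difference makes
  the choice by SOME harmless; \<open>W\<close> itself gives vanishing on P.\<close>

lemma extend_hom:
  assumes W: "\<And>f. poly_over A f \<Longrightarrow> poly f x \<in> P \<Longrightarrow> poly (map_poly \<phi> f) \<xi> = 0"
  shows "\<exists>\<phi>'. hom_mod (adjoin A x) \<phi>' \<and> (\<forall>y\<in>A. \<phi>' y = \<phi> y) \<and>
           (\<forall>f. poly_over A f \<longrightarrow> \<phi>' (poly f x) = poly (map_poly \<phi> f) \<xi>)"
proof -
  define \<phi>' where "\<phi>' = (\<lambda>y. poly (map_poly \<phi> (SOME f. poly_over A f \<and> poly f x = y)) \<xi>)"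
  have eq: "poly (map_poly \<phi> f) \<xi> = poly (map_poly \<phi> g) \<xi>"
    if "poly_over A f" "poly_over A g" "poly f x = poly g x" for f g
  proof -
    have d: "poly_over A (f - g)" using that A poly_over_diff by blast
    have "map_poly \<phi> f = map_poly \<phi> (f - g) + map_poly \<phi> g"
      using map_hom_add[OF d that(2)] by simp
    moreover have "poly (map_poly \<phi> (f - g)) \<xi> = 0"
      using that by (intro W d) (simp add: zero_mem)
    ultimately show ?thesis by simp
  qed
  have \<phi>': "\<phi>' (poly f x) = poly (map_poly \<phi> f) \<xi>" if "poly_over A f" for f
    unfolding \<phi>'_def using someI[of "\<lambda>g. poly_over A g \<and> poly g x = poly f x" f] that
    by (intro eq) auto
  have ext: "\<phi>' y = \<phi> y" if "y \<in> A" for y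
    using \<phi>'[OF poly_over_const[OF A that]] by (simp add: map_poly_pCons hom_zero)
  have "hom_mod (adjoin A x) \<phi>'"
    unfolding hom_mod_def
  proof (intro conjI ballI)
    show "\<phi>' 1 = 1" using ext[of 1] A \<phi> by (auto simp: subring_closed_def hom_mod_def)
  next
    fix y z assume "y \<in> adjoin A x" "z \<in> adjoin A x"
    then obtain f g where fg: "poly_over A f" "y = poly f x" "poly_over A g" "z = poly g x"
      by (auto simp: adjoin_def)
    show "\<phi>' (y + z) = \<phi>' y + \<phi>' z"
      using \<phi>'[OF poly_over_add[OF A fg(1,3)]] fg \<phi>' map_hom_add by simp
    show "\<phi>' (y * z) = \<phi>' y * \<phi>' z"
      using \<phi>'[OF poly_over_mult[OF A fg(1,3)]] fg \<phi>' map_hom_mult by simp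
  next
    fix y assume "y \<in> adjoin A x \<inter> P"
    then obtain f where "poly_over A f" "y = poly f x" "y \<in> P" by (auto simp: adjoin_def)
    then show "\<phi>' y = 0" using \<phi>' W by simp
  qed
  with ext \<phi>' show ?thesis by blast
qed

end

text \<open>The one-variable step of the extension theorem for homomorphisms into an algebraically
  closed field, with the domain \<open>R/P\<close> represented by congruences modulo \<open>P\<close>. If \<open>x\<close> is
  algebraic over \<open>A\<close> modulo \<open>P\<close>, a relation \<open>p\<close> of minimal degree plays the role of a minimal
  polynomial, and \<open>x\<close> may be sent to any root of its image.\<close>

lemma extension_step:
  assumes A: "subring_closed A" and b: "b \<in> adjoin A x" "b \<notin> P"
  shows "\<exists>a\<in>A. a \<notin> P \<and> (\<forall>\<phi> :: 'r \<Rightarrow> 'a::alg_closed_field. hom_mod A \<phi> \<longrightarrow> \<phi> a \<noteq> 0 \<longrightarrow>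
           (\<exists>\<phi>'. hom_mod (adjoin A x) \<phi>' \<and> (\<forall>y\<in>A. \<phi>' y = \<phi> y) \<and> \<phi>' b \<noteq> 0))"
proof -
  obtain g where g: "poly_over A g" "b = poly g x" using b by (auto simp: adjoin_def)
  define Rel where "Rel = (\<lambda>f. poly_over A f \<and> poly f x \<in> P \<and> lead_coeff f \<notin> P)"
  show ?thesis
  proof (cases "\<exists>f. Rel f")
    case False
    \<comment> \<open>Here x is transcendental modulo P: stripping a relation with some coefficient
      outside P would produce an instance of \<open>Rel\<close>.\<close>
    have rel: "poly_over P f" if "poly_over A f" "poly f x \<in> P" for f
    proof (rule ccontr)
      assume "\<not> poly_over P f"
      then have "strip f \<noteq> 0" by (simp add: strip_eq_0)
      then have "Rel (strip f)" unfolding Rel_def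
        using that strip_over[OF A] lead_strip poly_strip mem_cong by blast
      then show False using False by blast
    qed
    from b g have "\<not> poly_over P g" using poly_mem by auto
    then obtain i where i: "coeff g i \<notin> P" by (auto simp: poly_over_def)
    show ?thesis
    \<comment> \<open>If \<phi> does not kill this one coefficient, the image of g is a nonzero
      polynomial, and x may be sent to any of its non-roots.\<close>
    proof (intro bexI[of _ "coeff g i"] conjI allI impI)
      show "coeff g i \<in> A" using g by (auto simp: poly_over_def)
      show "coeff g i \<notin> P" by (rule i)
    next
      fix \<phi> :: "'r \<Rightarrow> 'a" assume \<phi>: "hom_mod A \<phi>" "\<phi> (coeff g i) \<noteq> 0"
      have "coeff (map_poly \<phi> g) i \<noteq> 0" using \<phi>(2) by (simp add: coeff_map_poly hom_zero[OF A \<phi>(1)])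
      then have "map_poly \<phi> g \<noteq> 0" by auto
      then obtain \<xi> where \<xi>: "poly (map_poly \<phi> g) \<xi> \<noteq> 0" using nonroot_exists by blast
      have "poly (map_poly \<phi> f) \<xi> = 0" if "poly_over A f" "poly f x \<in> P" for f
        using map_hom_zero[OF A \<phi>(1) that(1) rel[OF that]] by simp
      from extend_hom[OF A \<phi>(1) this] show "\<exists>\<phi>'. hom_mod (adjoin A x) \<phi>' \<and> (\<forall>y\<in>A. \<phi>' y = \<phi> y) \<and> \<phi>' b \<noteq> 0"
        using \<xi> g by metis
    qed
  next
    case True
    then obtain p where p: "Rel p" and pmin: "\<And>f. Rel f \<Longrightarrow> degree p \<le> degree f"
      by (metis arg_min_natI arg_min_nat_le)
    define \<alpha> where "\<alpha> = lead_coeff p"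
    have pA: "poly_over A p" "poly p x \<in> P" "\<alpha> \<notin> P" "\<alpha> \<in> A"
      using p by (auto simp: Rel_def \<alpha>_def poly_over_def)
    \<comment> \<open>Below the minimal degree every relation is trivial modulo P, because stripping
      does not raise the degree.\<close>
    have rel: "poly_over P f" if "poly_over A f" "poly f x \<in> P" "degree f < degree p" for f
    proof (rule ccontr)
      assume "\<not> poly_over P f"
      then have "strip f \<noteq> 0" by (simp add: strip_eq_0)
      then have "Rel (strip f)" unfolding Rel_def
        using that strip_over[OF A] lead_strip poly_strip mem_cong by blast
      then show False using pmin degree_strip[of f] that(3) by (meson leD order_trans)
    qed
    have dp: "degree p > 0"
    proof (rule ccontr)
      assume "\<not> degree p > 0"
      then have "poly p x = \<alpha>" by (metis \<alpha>_def degree_eq_zeroE gr0I lead_coeff_pCons(2) poly_const_conv)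
      with pA show False by simp
    qed
    \<comment> \<open>As x is algebraic modulo P, b becomes invertible over the fraction field of
      A/P. Clearing denominators, some multiple of b is congruent to an element a of A outside
      P.\<close>
    have inv: "\<exists>a\<in>A. a \<notin> P \<and> (\<exists>w. poly_over A w \<and> a - poly w x * b \<in> P)"
    proof -
      \<comment> \<open>Values at x congruent to multiples of b, but nonzero modulo P. A member of
        minimal degree plays the role of the gcd in Bezout's identity; it turns out to be
        constant.\<close>
      define H where "H = (\<lambda>h. poly_over A h \<and> poly h x \<notin> P \<and> lead_coeff h \<notin> P \<and>
        (\<exists>w. poly_over A w \<and> poly h x - poly w x * b \<in> P))"
      have Hstrip: "H (strip h)" if h: "poly_over A h" "poly h x \<notin> P"
        "poly_over A w" "poly h x - poly w x * b \<in> P" for h w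
      proof -
        have "poly (strip h) x \<notin> P" using h mem_cong[OF poly_strip] by blast
        moreover from this have "strip h \<noteq> 0" using zero_mem by auto
        moreover have "poly (strip h) x - poly w x * b \<in> P"
          using diff_mem[OF h(4) poly_strip[of h x]] by (simp add: algebra_simps)
        ultimately show ?thesis unfolding H_def using lead_strip strip_over[OF A h(1)] h(3) by blast
      qed
      have "poly g x - poly 1 x * b \<in> P" using g zero_mem by simp
      moreover have "poly_over A 1"
        using poly_over_const[OF A, of 1] A by (simp add: subring_closed_def one_pCons)
      ultimately have "H (strip g)" using Hstrip[of g 1] g b by blast
      then obtain h where h: "H h" and hmin: "\<And>f. H f \<Longrightarrow> degree h \<le> degree f"
        by (metis arg_min_natI arg_min_nat_le)
      from h obtain w where w: "poly_over A w" "poly h x - poly w x * b \<in> P" by (auto simp: H_def)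
      have hA: "poly_over A h" "poly h x \<notin> P" "lead_coeff h \<notin> P" "lead_coeff h \<in> A"
        using h by (auto simp: H_def poly_over_def)
      have hlow: "poly r x \<in> P" if "poly_over A r" "degree r < degree h" "poly_over A u"
        "poly r x - poly u x * b \<in> P" for r u
        using Hstrip[OF that(1) _ that(3,4)] hmin degree_strip[of r] that(2) by (meson leD order_trans)
      \<comment> \<open>Otherwise h could be reduced by p: since p vanishes at x modulo P, the
        remainder is still congruent to a multiple of b and still nonzero, contradicting
        minimality.\<close>
      have dh: "degree h < degree p"
      proof (rule ccontr)
        assume "\<not> degree h < degree p"
        from pseudo_division_over[OF A pA(1) dp hA(1)] obtain s q r where
          d: "smult (\<alpha> ^ s) h = p * q + r" "degree r < degree p" "poly_over A q" "poly_over A r"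
          unfolding \<alpha>_def by blast
        have e: "\<alpha> ^ s * poly h x = poly p x * poly q x + poly r x"
          using arg_cong[OF d(1), of "\<lambda>f. poly f x"] by simp
        have "poly r x \<notin> P"
        proof
          assume "poly r x \<in> P"
          then have "\<alpha> ^ s * poly h x \<in> P" unfolding e using pA(2) by (intro add_mem mult_mem2) auto
          then show False using hA pA power_not_mem prime by blast
        qed
        moreover have "poly r x - poly (smult (\<alpha> ^ s) w) x * b \<in> P"
        proof -
          have "poly r x - poly (smult (\<alpha> ^ s) w) x * b =
              \<alpha> ^ s * (poly h x - poly w x * b) - poly p x * poly q x"
            using e by (simp add: algebra_simps)
          then show ?thesis using w pA(2) by (auto intro: diff_mem mult_mem mult_mem2)
        qed
        ultimately show False
          using hlow[OF d(4), of "smult (\<alpha> ^ s) w"] d(2) \<open>\<not> degree h < degree p\<close> A pA(4) w(1)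
          by (auto intro: poly_over_smult subring_power)
      qed
      \<comment> \<open>Otherwise divide p by h. Minimality of h makes the remainder vanish at x
        modulo P, so by primality the quotient does too. Both have degree below that of p, hence
        have all coefficients in P, which would force a power of \<open>?\<beta>\<close> times
        \<alpha> into P.\<close>
      have "degree h = 0"
      proof (rule ccontr)
        assume dh0: "degree h \<noteq> 0"
        let ?\<beta> = "lead_coeff h"
        from pseudo_division_over[OF A hA(1) _ pA(1)] dh0 obtain s q r where
          d: "smult (?\<beta> ^ s) p = h * q + r" "degree r < degree h"
            "degree q \<le> degree p - degree h" "poly_over A q" "poly_over A r" by blast
        have e: "?\<beta> ^ s * poly p x = poly h x * poly q x + poly r x"
          using arg_cong[OF d(1), of "\<lambda>f. poly f x"] by simp
        have "poly r x - poly (- (w * q)) x * b =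
            ?\<beta> ^ s * poly p x - (poly h x - poly w x * b) * poly q x"
          using e by (simp add: algebra_simps)
        then have "poly r x - poly (- (w * q)) x * b \<in> P"
          using w(2) pA(2) by (simp add: diff_mem mult_mem mult_mem2)
        then have r: "poly r x \<in> P"
          using hlow[OF d(5,2)] A w(1) d(4) poly_over_minus poly_over_mult by blast
        have "poly h x * poly q x = ?\<beta> ^ s * poly p x - poly r x" using e by simp
        then have "poly h x * poly q x \<in> P" using r pA(2) by (simp add: diff_mem mult_mem)
        then have "poly q x \<in> P" using hA prime by blast
        then have "poly_over P q" using rel[OF d(4)] d(3) dh dh0 by linarith
        moreover have "poly_over P r" using rel[OF d(5) r] d(2) dh by linarith
        ultimately have "poly_over P (h * q + r)"
          unfolding poly_over_def coeff_add coeff_mult by (auto intro!: add_mem sum_mem mult_mem)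
        then have "?\<beta> ^ s * \<alpha> \<in> P"
          unfolding d(1)[symmetric] poly_over_def \<alpha>_def by (metis coeff_smult)
        then show False using hA pA power_not_mem prime by blast
      qed
      then have "poly h x = lead_coeff h"
        by (metis degree_eq_zeroE lead_coeff_pCons(2) poly_const_conv)
      then show ?thesis using hA w by auto
    qed
    then obtain a w where a: "a \<in> A" "a \<notin> P" "poly_over A w" "a - poly w x * b \<in> P" by blast
    show ?thesis
    \<comment> \<open>Nonvanishing of \<phi> at \<alpha> keeps the degree of the image of p
      positive, so that it has a root; nonvanishing at a passes to b because a is congruent to a
      multiple of b.\<close>
    proof (intro bexI[of _ "\<alpha> * a"] conjI allI impI)
      show "\<alpha> * a \<in> A" using A a pA by (auto simp: subring_closed_def)
      show "\<alpha> * a \<notin> P" using a pA prime by blast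
    next
      fix \<phi> :: "'r \<Rightarrow> 'a" assume \<phi>: "hom_mod A \<phi>" "\<phi> (\<alpha> * a) \<noteq> 0"
      then have nz: "\<phi> \<alpha> \<noteq> 0" "\<phi> a \<noteq> 0" using a pA by (auto simp: hom_mod_def)
      have "degree (map_poly \<phi> p) \<ge> degree p"
        using nz(1) by (intro le_degree) (simp add: coeff_map_poly hom_zero[OF A \<phi>(1)] \<alpha>_def)
      then obtain \<xi> where \<xi>: "poly (map_poly \<phi> p) \<xi> = 0"
        using dp alg_closed_imp_poly_has_root[of "map_poly \<phi> p"] by auto
      \<comment> \<open>Pseudo-division by p leaves a remainder that is a relation below minimal
        degree, hence killed by \<phi>. So a nonzero multiple of the image of f is divisible by the
        image of p.\<close>
      have "poly (map_poly \<phi> f) \<xi> = 0" if f: "poly_over A f" "poly f x \<in> P" for f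
      proof -
        from pseudo_division_over[OF A pA(1) dp f(1)] obtain s q r where
          d: "smult (\<alpha> ^ s) f = p * q + r" "degree r < degree p" "poly_over A q" "poly_over A r"
          unfolding \<alpha>_def by blast
        have "poly r x = \<alpha> ^ s * poly f x - poly p x * poly q x"
          using arg_cong[OF d(1), of "\<lambda>f. poly f x"] by simp
        then have "poly r x \<in> P" using f pA by (simp add: diff_mem mult_mem mult_mem2)
        then have "map_poly \<phi> r = 0" using map_hom_zero[OF A \<phi>(1)] rel d by blast
        moreover have "map_poly \<phi> (smult (\<alpha> ^ s) f) = smult (\<phi> \<alpha> ^ s) (map_poly \<phi> f)"
          using map_hom_smult[OF A \<phi>(1)] hom_power[OF A \<phi>(1)] subring_power[OF A] pA f by metis
        ultimately have "smult (\<phi> \<alpha> ^ s) (map_poly \<phi> f) = map_poly \<phi> p * map_poly \<phi> q"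
          using map_hom_add[OF A \<phi>(1) poly_over_mult[OF A pA(1) d(3)] d(4)]
            map_hom_mult[OF A \<phi>(1) pA(1) d(3)] d(1) by simp
        from arg_cong[OF this, of "\<lambda>f. poly f \<xi>"] show ?thesis using \<xi> nz by simp
      qed
      from extend_hom[OF A \<phi>(1) this] obtain \<phi>' where
        \<phi>': "hom_mod (adjoin A x) \<phi>'" "\<forall>y\<in>A. \<phi>' y = \<phi> y" by blast
      have S: "subring_closed (adjoin A x)" by (rule subring_adjoin[OF A])
      have wx: "poly w x \<in> adjoin A x" using a by (auto simp: adjoin_def)
      then have wb: "poly w x * b \<in> adjoin A x" using S b by (auto simp: subring_closed_def)
      have aB: "a \<in> adjoin A x" using a subset_adjoin[OF A] by auto
      then have "a - poly w x * b \<in> adjoin A x"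
        using S wb unfolding subring_closed_def by (metis add_uminus_conv_diff)
      then have "\<phi>' a = \<phi>' (poly w x * b)"
        using \<phi>'(1) a(4) wb unfolding hom_mod_def
        by (metis IntI add.left_neutral diff_add_cancel)
      then have "\<phi>' b \<noteq> 0" using \<phi>' nz a wx b by (auto simp: hom_mod_def)
      with \<phi>' show "\<exists>\<phi>'. hom_mod (adjoin A x) \<phi>' \<and> (\<forall>y\<in>A. \<phi>' y = \<phi> y) \<and> \<phi>' b \<noteq> 0" by blast
    qed
  qed
qed

end


section \<open>Substitution into multivariate polynomials\<close>

lemma poly_mapping_sum_single:
  "(\<Sum>m\<in>Poly_Mapping.keys P. Poly_Mapping.single m (Poly_Mapping.lookup P m)) = P"
  by (intro poly_mapping_eqI) (auto simp: lookup_sum lookup_single when_def in_keys_iff)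

lemma mpoly_subst_single:
  assumes "h 0 = 0"
  shows "mpoly_subst h (Poly_Mapping.single m c) x =
           h c * (\<Prod>i\<in>UNIV. (x $ i) ^ Poly_Mapping.lookup m i)"
  using assms by (cases "c = 0") (simp_all add: mpoly_subst_def)

context
  fixes h :: "'a::comm_ring_1 \<Rightarrow> 'b::comm_ring_1"
  assumes h0: "h 0 = 0" and hadd: "\<And>a b. h (a + b) = h a + h b"
begin

lemma mpoly_subst_superset:
  assumes "finite S" "Poly_Mapping.keys P \<subseteq> S"
  shows "mpoly_subst h P x =
    (\<Sum>m\<in>S. h (Poly_Mapping.lookup P m) * (\<Prod>i\<in>UNIV. (x $ i) ^ Poly_Mapping.lookup m i))"
  unfolding mpoly_subst_def
  using assms by (intro sum.mono_neutral_left) (auto simp: in_keys_iff h0)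

lemma mpoly_subst_add: "mpoly_subst h (P + Q) x = mpoly_subst h P x + mpoly_subst h Q x"
proof -
  have fin: "finite (Poly_Mapping.keys P \<union> Poly_Mapping.keys Q)" by simp
  show ?thesis
    using keys_add[of P Q]
    by (simp add: mpoly_subst_superset[OF fin] lookup_add hadd sum.distrib ring_distribs)
qed

lemma mpoly_subst_sum: "mpoly_subst h (sum g I) x = (\<Sum>i\<in>I. mpoly_subst h (g i) x)"
  by (induction I rule: infinite_finite_induct)
     (simp_all add: mpoly_subst_add, simp_all add: mpoly_subst_def)

lemma mpoly_subst_mult:
  assumes hmult: "\<And>a b. h (a * b) = h a * h b"
  shows "mpoly_subst h (P * Q) x = mpoly_subst h P x * mpoly_subst h Q x"
proof -
  let ?P = "\<lambda>m. Poly_Mapping.single m (Poly_Mapping.lookup P m)"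
  let ?Q = "\<lambda>m. Poly_Mapping.single m (Poly_Mapping.lookup Q m)"
  have "P * Q = (\<Sum>m\<in>Poly_Mapping.keys P. ?P m) * (\<Sum>l\<in>Poly_Mapping.keys Q. ?Q l)"
    by (simp only: poly_mapping_sum_single)
  also have "\<dots> = (\<Sum>m\<in>Poly_Mapping.keys P. \<Sum>l\<in>Poly_Mapping.keys Q. ?P m * ?Q l)"
    by (rule sum_product)
  finally have "mpoly_subst h (P * Q) x =
      (\<Sum>m\<in>Poly_Mapping.keys P. \<Sum>l\<in>Poly_Mapping.keys Q. mpoly_subst h (?P m * ?Q l) x)"
    by (simp add: mpoly_subst_sum)
  also have "\<dots> = (\<Sum>m\<in>Poly_Mapping.keys P. \<Sum>l\<in>Poly_Mapping.keys Q.
      mpoly_subst h (?P m) x * mpoly_subst h (?Q l) x)"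
    by (intro sum.cong refl)
       (simp add: mult_single mpoly_subst_single h0 hmult lookup_add power_add prod.distrib mult_ac)
  also have "\<dots> = mpoly_subst h (\<Sum>m\<in>Poly_Mapping.keys P. ?P m) x *
      mpoly_subst h (\<Sum>l\<in>Poly_Mapping.keys Q. ?Q l) x"
    by (simp only: sum_product mpoly_subst_sum)
  finally show ?thesis by (simp only: poly_mapping_sum_single)
qed

lemma mpoly_subst_power:
  assumes "\<And>a b. h (a * b) = h a * h b" "h 1 = 1"
  shows "mpoly_subst h (P ^ n) x = mpoly_subst h P x ^ n"
proof (induction n)
  case 0
  have "mpoly_subst h (Poly_Mapping.single 0 1) x = 1"
    by (subst mpoly_subst_single) (simp_all add: h0 assms)
  then show ?case by simp
qed (simp add: mpoly_subst_mult assms)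

end

section \<open>Variables as elements of the polynomial ring\<close>

definition mpoly_var :: "'N \<Rightarrow> ('a::comm_ring_1, 'N) mpoly" where
  "mpoly_var i = Poly_Mapping.single (Poly_Mapping.single i 1) 1"

lemma mpoly_subst_var:
  fixes x :: "'b::comm_semiring_1 ^ 'N::finite"
  assumes "h 0 = 0" "h 1 = 1"
  shows "mpoly_subst h (mpoly_var i :: ('a::comm_ring_1, 'N) mpoly) x = x $ i"
proof -
  have "(\<Prod>j\<in>UNIV. (x $ j) ^ Poly_Mapping.lookup (Poly_Mapping.single i (1::nat)) j) =
      (\<Prod>j\<in>UNIV. if j = i then x $ j else 1)"
    by (intro prod.cong) (auto simp: lookup_single when_def)
  then show ?thesis
    unfolding mpoly_var_def by (subst mpoly_subst_single) (simp_all add: assms)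
qed

lemma mpoly_var_power: "mpoly_var i ^ k = Poly_Mapping.single (Poly_Mapping.single i k) 1"
  by (induction k) (simp_all add: mpoly_var_def mult_single single_add[symmetric])

lemma prod_single_one:
  "(\<Prod>i\<in>I. Poly_Mapping.single (g i) (1::'a::comm_ring_1)) =
     Poly_Mapping.single (\<Sum>i\<in>I. g i :: 'b::comm_monoid_add) 1"
  by (induction I rule: infinite_finite_induct) (simp_all add: mult_single)

text \<open>Writes a polynomial as an expression in constants and variables, so that a subring
  containing these is everything and a homomorphism is determined by its values on them.\<close>

lemma mpoly_subst_vars:
  fixes g :: "('a::comm_ring_1, 'N::finite) mpoly"
  shows "mpoly_subst (Poly_Mapping.single 0) g (\<chi> i. mpoly_var i) = g"
proof -
  have "(\<Sum>i\<in>UNIV. Poly_Mapping.single i (Poly_Mapping.lookup m i)) = m" for m :: "'N \<Rightarrow>\<^sub>0 nat"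
    by (intro poly_mapping_eqI) (simp add: lookup_sum lookup_single when_def)
  then have "mpoly_subst (Poly_Mapping.single 0) g (\<chi> i. mpoly_var i) =
      (\<Sum>m\<in>Poly_Mapping.keys g. Poly_Mapping.single m (Poly_Mapping.lookup g m))"
    by (simp add: mpoly_subst_def mpoly_var_power prod_single_one mult_single)
  then show ?thesis by (simp only: poly_mapping_sum_single)
qed


section \<open>The Nullstellensatz\<close>

lemma module_times: "module ((*) :: 'r::comm_ring_1 \<Rightarrow> 'r \<Rightarrow> 'r)"
  by standard (simp_all add: algebra_simps)

text \<open>An ideal maximal among those containing T and no power of b is prime: if x and y are
  outside it, some powers of b are congruent to multiples of x and of y, and their product would be
  in the ideal together with x y. Ideals are the subspaces of the ring as a module over
  itself.\<close>

lemma prime_ideal_avoiding_powers: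
  fixes b :: "'r::comm_ring_1"
  assumes "\<And>k. b ^ k \<notin> module.span (*) T"
  shows "\<exists>P. prime_ideal_set P \<and> T \<subseteq> P \<and> b \<notin> P"
proof -
  have expand: "u * w = w * (u - r * x) + (r * x) * (w - s * y) + (r * s) * (x * y)"
    for u w r s x y :: 'r
    by (simp add: algebra_simps)
  interpret ideal: module "(*) :: 'r \<Rightarrow> 'r \<Rightarrow> 'r" by (rule module_times)
  define \<A> where "\<A> = {J. ideal.subspace J \<and> T \<subseteq> J \<and> (\<forall>k. b ^ k \<notin> J)}"
  have "ideal.span T \<in> \<A>" unfolding \<A>_def using assms by (auto intro: ideal.span_base)
  then have "\<A> \<noteq> {}" by blast
  moreover have "\<Union>\<C> \<in> \<A>" if "\<C> \<noteq> {}" "subset.chain \<A> \<C>" for \<C>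
  proof -
    have sub: "\<C> \<subseteq> \<A>" and chain: "\<And>X Y. X \<in> \<C> \<Longrightarrow> Y \<in> \<C> \<Longrightarrow> X \<subseteq> Y \<or> Y \<subseteq> X"
      using that(2) by (auto simp: subset.chain_def)
    have "ideal.subspace (\<Union>\<C>)"
    proof (rule ideal.subspaceI)
      show "0 \<in> \<Union>\<C>" using that(1) sub ideal.subspace_0 by (fastforce simp: \<A>_def)
    next
      fix x y assume "x \<in> \<Union>\<C>" "y \<in> \<Union>\<C>"
      then obtain X where X: "X \<in> \<C>" "x \<in> X" "y \<in> X" using chain by (meson UnionE subsetD)
      then have "x + y \<in> X" using sub by (intro ideal.subspace_add) (auto simp: \<A>_def)
      then show "x + y \<in> \<Union>\<C>" using X by blast
    next
      fix c x assume "x \<in> \<Union>\<C>"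
      then obtain X where X: "X \<in> \<C>" "x \<in> X" by blast
      then have "c * x \<in> X" using sub by (intro ideal.subspace_scale) (auto simp: \<A>_def)
      then show "c * x \<in> \<Union>\<C>" using X by blast
    qed
    then show ?thesis using that(1) sub by (auto simp: \<A>_def)
  qed
  ultimately obtain P where P: "P \<in> \<A>" and Pmax: "\<And>X. X \<in> \<A> \<Longrightarrow> P \<subseteq> X \<Longrightarrow> X = P"
    using subset_Zorn_nonempty[of \<A>] by metis
  have S: "ideal.subspace P" and TP: "T \<subseteq> P" and bP: "\<And>k. b ^ k \<notin> P"
    using P by (auto simp: \<A>_def)
  have span: "ideal.span P = P" using S by simp
  have ex: "\<exists>k r. b ^ k - r * x \<in> P" if "x \<notin> P" for x
  proof -
    have "ideal.span (insert x P) \<noteq> P" using that ideal.span_base[of x "insert x P"] by blast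
    moreover have "P \<subseteq> ideal.span (insert x P)" using ideal.span_superset[of "insert x P"] by blast
    ultimately have "ideal.span (insert x P) \<notin> \<A>" using Pmax by blast
    then obtain k where "b ^ k \<in> ideal.span (insert x P)"
      using TP \<open>P \<subseteq> _\<close> unfolding \<A>_def by auto
    then show ?thesis using ideal.span_breakdown_eq[of "b ^ k" x P] span by auto
  qed
  have "prime_ideal_set P"
  proof
    show "0 \<in> P" using S by (rule ideal.subspace_0)
    show "x + y \<in> P" if "x \<in> P" "y \<in> P" for x y using S that by (rule ideal.subspace_add)
    show m: "x * y \<in> P" if "y \<in> P" for x y using S that by (rule ideal.subspace_scale)
    show "1 \<notin> P" using bP[of 0] by simp
    show "x \<in> P \<or> y \<in> P" if xy: "x * y \<in> P" for x y
    proof (rule ccontr)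
      assume "\<not> (x \<in> P \<or> y \<in> P)"
      then obtain k r l s where kl: "b ^ k - r * x \<in> P" "b ^ l - s * y \<in> P" using ex by meson
      have "b ^ (k + l) = b ^ l * (b ^ k - r * x) + (r * x) * (b ^ l - s * y) + (r * s) * (x * y)"
        unfolding power_add by (rule expand)
      also have "\<dots> \<in> P"
        by (intro ideal.subspace_add[OF S] ideal.subspace_scale[OF S kl(1)]
            ideal.subspace_scale[OF S kl(2)] ideal.subspace_scale[OF S xy])
      finally show False using bP by blast
    qed
  qed
  moreover have "b \<notin> P" using bP[of 1] by simp
  ultimately show ?thesis using TP by blast
qed

text \<open>With P prime, containing T and not b, a homomorphism modulo P to the field that does not
  kill b is evaluation at the point formed by the images of the variables. This point is a zero of T
  but not of b.\<close>

lemma nullstellensatz: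
  fixes T :: "('a::alg_closed_field, 'N::finite) mpoly set"
  assumes "\<And>x. (\<And>g. g \<in> T \<Longrightarrow> mpoly_subst (\<lambda>c. c) g x = 0) \<Longrightarrow> mpoly_subst (\<lambda>c. c) b x = 0"
  shows "\<exists>k. b ^ k \<in> module.span (*) T"
proof (rule ccontr)
  assume "\<not> ?thesis"
  then obtain P where P: "prime_ideal_set P" "T \<subseteq> P" "b \<notin> P"
    using prime_ideal_avoiding_powers[of b T] by blast
  interpret prime_ideal_set P by (rule P)
  define A where
    "A = (\<lambda>js :: 'N list. foldr (\<lambda>i A. adjoin A (mpoly_var i)) js (range (Poly_Mapping.single 0 :: 'a \<Rightarrow> ('a, 'N) mpoly)))"
  \<comment> \<open>The invariant speaks of every y outside P, not only of b, because adjoining a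
    variable replaces the element that must survive by another one of the smaller ring.\<close>
  have "subring_closed (A js) \<and> range (Poly_Mapping.single 0) \<subseteq> A js \<and> mpoly_var ` set js \<subseteq> A js \<and>
      (\<forall>y\<in>A js. y \<notin> P \<longrightarrow> (\<exists>\<phi> :: _ \<Rightarrow> 'a. hom_mod (A js) \<phi> \<and> \<phi> y \<noteq> 0 \<and> (\<forall>c. \<phi> (Poly_Mapping.single 0 c) = c)))"
    for js
  proof (induction js)
    case Nil
    have A: "A [] = range (Poly_Mapping.single 0)" by (simp add: A_def)
    have "subring_closed (A [])"
      unfolding A subring_closed_def
      by (auto simp: mult_single single_add[symmetric] single_uminus[symmetric] image_iff
          intro: exI[of _ 0] exI[of _ 1])
    \<comment> \<open>Nonzero constants are units and so lie outside P; hence taking the constant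
      coefficient is a homomorphism modulo P on the ring of constants.\<close>
    moreover have c0: "c = 0" if "Poly_Mapping.single 0 c \<in> P" for c :: 'a
    proof (rule ccontr)
      assume "c \<noteq> 0"
      then have "1 = Poly_Mapping.single 0 (inverse c) * Poly_Mapping.single (0 :: 'N \<Rightarrow>\<^sub>0 nat) c"
        by (simp add: mult_single)
      then show False using mult_mem[OF that] one_not_mem by metis
    qed
    moreover have "hom_mod (A []) (\<lambda>g. Poly_Mapping.lookup g 0)"
      unfolding hom_mod_def A by (auto simp: lookup_add mult_single dest: c0)
    ultimately show ?case
      by (auto simp: A intro!: exI[of _ "\<lambda>g. Poly_Mapping.lookup g 0"] simp: zero_mem)
  next
    case (Cons i js)
    have A: "A (i # js) = adjoin (A js) (mpoly_var i)" by (simp add: A_def)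
    have S: "subring_closed (A js)" using Cons by blast
    have sub: "A js \<subseteq> A (i # js)" unfolding A by (rule subset_adjoin[OF S])
    have "\<exists>\<phi> :: _ \<Rightarrow> 'a. hom_mod (A (i # js)) \<phi> \<and> \<phi> y \<noteq> 0 \<and> (\<forall>c. \<phi> (Poly_Mapping.single 0 c) = c)"
      if y: "y \<in> A (i # js)" "y \<notin> P" for y
    proof -
      from extension_step[OF S y(1)[unfolded A] y(2), where 'a = 'a] obtain a where
        a: "a \<in> A js" "a \<notin> P" and ext: "\<And>\<phi> :: _ \<Rightarrow> 'a. hom_mod (A js) \<phi> \<Longrightarrow> \<phi> a \<noteq> 0 \<Longrightarrow>
           (\<exists>\<phi>'. hom_mod (A (i # js)) \<phi>' \<and> (\<forall>y\<in>A js. \<phi>' y = \<phi> y) \<and> \<phi>' y \<noteq> 0)"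
        unfolding A by blast
      from Cons a obtain \<phi> :: "_ \<Rightarrow> 'a" where
        \<phi>: "hom_mod (A js) \<phi>" "\<phi> a \<noteq> 0" "\<And>c. \<phi> (Poly_Mapping.single 0 c) = c" by blast
      from ext[OF \<phi>(1,2)] obtain \<phi>' where
        "hom_mod (A (i # js)) \<phi>'" "\<forall>y\<in>A js. \<phi>' y = \<phi> y" "\<phi>' y \<noteq> 0" by blast
      moreover have "Poly_Mapping.single 0 c \<in> A js" for c using Cons by blast
      ultimately show ?thesis using \<phi>(3) by (intro exI[of _ \<phi>']) auto
    qed
    moreover have "subring_closed (A (i # js))" unfolding A by (rule subring_adjoin[OF S])
    moreover have "mpoly_var i \<in> A (i # js)" unfolding A by (rule mem_adjoin[OF S])
    ultimately show ?case using Cons sub by auto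
  qed
  moreover obtain js where "set js = (UNIV :: 'N set)" using finite_list[of "UNIV :: 'N set"] by auto
  ultimately have S: "subring_closed (A js)" and c: "\<And>c. Poly_Mapping.single 0 c \<in> A js"
    and v: "\<And>i. mpoly_var i \<in> A js"
    and hom: "b \<in> A js \<Longrightarrow> \<exists>\<phi> :: _ \<Rightarrow> 'a. hom_mod (A js) \<phi> \<and> \<phi> b \<noteq> 0 \<and> (\<forall>c. \<phi> (Poly_Mapping.single 0 c) = c)"
    using P(3) by (metis subsetD rangeI, metis subsetD rangeI, metis subsetD imageI UNIV_I, metis)
  have prod: "(\<Prod>i\<in>I. mpoly_var i ^ m i) \<in> A js" for I :: "'N set" and m
    using S by (induction I rule: infinite_finite_induct)
      (auto simp: subring_closed_def intro!: subring_power[OF S] v)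
  have mon: "Poly_Mapping.single 0 a * (\<Prod>i\<in>I. mpoly_var i ^ m i) \<in> A js" for I :: "'N set" and m a
    using S prod c by (auto simp: subring_closed_def)
  have univ: "g \<in> A js" for g
  proof -
    have "mpoly_subst (Poly_Mapping.single 0) g (\<chi> i. mpoly_var i) \<in> A js"
      unfolding mpoly_subst_def by (intro subring_sum[OF S]) (simp add: mon)
    then show ?thesis by (simp only: mpoly_subst_vars)
  qed
  from hom[OF univ] obtain \<phi> :: "_ \<Rightarrow> 'a" where
    \<phi>: "hom_mod (A js) \<phi>" "\<phi> b \<noteq> 0" "\<And>c. \<phi> (Poly_Mapping.single 0 c) = c" by blast
  have mult: "\<phi> (x * y) = \<phi> x * \<phi> y" for x y using \<phi>(1) univ by (auto simp: hom_mod_def)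
  have hprod: "\<phi> (\<Prod>i\<in>I. mpoly_var i ^ m i) = (\<Prod>i\<in>I. \<phi> (mpoly_var i) ^ m i)" for I :: "'N set" and m
    using \<phi>(1) by (induction I rule: infinite_finite_induct)
      (auto simp: mult hom_power[OF S \<phi>(1) univ] hom_mod_def)
  have eval: "\<phi> g = mpoly_subst (\<lambda>c. c) g (\<chi> i. \<phi> (mpoly_var i))" for g
  proof -
    have "\<phi> g = \<phi> (mpoly_subst (Poly_Mapping.single 0) g (\<chi> i. mpoly_var i))"
      by (simp only: mpoly_subst_vars)
    also have "\<dots> = mpoly_subst (\<lambda>c. c) g (\<chi> i. \<phi> (mpoly_var i))"
      unfolding mpoly_subst_def hom_sum[OF S \<phi>(1) univ]
      by (simp only: mult hprod \<phi>(3) vec_lambda_beta)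
    finally show ?thesis .
  qed
  have "mpoly_subst (\<lambda>c. c) b (\<chi> i. \<phi> (mpoly_var i)) = 0"
  proof (rule assms)
    fix g assume "g \<in> T"
    then have "\<phi> g = 0" using P(2) \<phi>(1) univ by (auto simp: hom_mod_def)
    then show "mpoly_subst (\<lambda>c. c) g (\<chi> i. \<phi> (mpoly_var i)) = 0" by (simp only: eval[symmetric])
  qed
  then show False using \<phi>(2) by (simp only: eval[symmetric])
qed


section \<open>Entire functions over a non-Archimedean field\<close>

lemma null_seq_comparison:
  fixes a b :: "nat \<Rightarrow> real"
  assumes "b \<longlonglongrightarrow> 0" "\<And>m. 0 \<le> a m" "\<And>m. a m \<le> b m"
  shows "a \<longlonglongrightarrow> 0"
  using assms by (intro tendsto_sandwich[OF _ _ tendsto_const assms(1), of a]) auto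

lemma null_seq_bound:
  fixes a :: "nat \<Rightarrow> real"
  assumes "a \<longlonglongrightarrow> 0"
  obtains A where "0 < A" "\<And>j. a j \<le> A"
proof -
  have "Bseq a" using assms by (intro convergent_imp_Bseq) (auto simp: convergent_def)
  then obtain A where "0 < A" "\<And>j. norm (a j) \<le> A" by (auto simp: Bseq_def)
  then show ?thesis using that[of A] by (metis abs_le_D1 real_norm_def)
qed

locale nonarch_field =
  fixes v :: "'a::field \<Rightarrow> real"
  assumes nonarch: "nonarch_abs v"
begin

lemma v_nonneg [simp]: "0 \<le> v x"
  and v_eq_0 [simp]: "v x = 0 \<longleftrightarrow> x = 0"
  and v_mult: "v (x * y) = v x * v y"
  and v_add: "v (x + y) \<le> max (v x) (v y)"
  using nonarch by (auto simp: nonarch_abs_def)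

lemma v_zero [simp]: "v 0 = 0"
  by simp

lemma v_pos [simp]: "0 < v x \<longleftrightarrow> x \<noteq> 0"
  using v_nonneg[of x] v_eq_0[of x] by linarith

lemma v_one [simp]: "v 1 = 1"
  using v_mult[of 1 1] v_eq_0[of 1] by (metis mult_cancel_right1 one_neq_zero)

lemma v_minus [simp]: "v (- x) = v x"
proof -
  have "v (- 1) * v (- 1) = 1" using v_mult[of "-1" "-1"] by simp
  then have "v (- 1) = 1"
    using v_nonneg[of "-1"] by (metis abs_of_nonneg abs_square_eq_1 power2_eq_square)
  then show ?thesis using v_mult[of "-1" x] by simp
qed

lemma v_diff: "v (x - y) \<le> max (v x) (v y)"
  using v_add[of x "- y"] by simp

lemma v_diff_commute: "v (x - y) = v (y - x)"
  using v_minus[of "x - y"] by simp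

lemma v_power: "v (x ^ n) = v x ^ n"
  by (induction n) (simp_all add: v_mult)

lemma v_inverse: "v (inverse x) = inverse (v x)"
proof (cases "x = 0")
  case False
  then have "v (inverse x) * v x = 1" by (simp flip: v_mult)
  then show ?thesis by (metis inverse_unique mult.commute)
qed simp

lemma v_sum_le: "0 \<le> B \<Longrightarrow> (\<And>i. i \<in> I \<Longrightarrow> v (g i) \<le> B) \<Longrightarrow> v (sum g I) \<le> B"
proof (induction I rule: infinite_finite_induct)
  case (insert i I)
  then have "max (v (g i)) (v (sum g I)) \<le> B" by simp
  then show ?case using order_trans[OF v_add] insert by simp
qed auto

lemma v_sum_less: "0 < B \<Longrightarrow> (\<And>i. i \<in> I \<Longrightarrow> v (g i) < B) \<Longrightarrow> v (sum g I) < B"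
proof (induction I rule: infinite_finite_induct)
  case (insert i I)
  then have "max (v (g i)) (v (sum g I)) < B" by simp
  then show ?case using le_less_trans[OF v_add] insert by simp
qed auto

lemma v_add_eq: "v y < v x \<Longrightarrow> v (x + y) = v x"
  using v_add[of x y] v_diff[of "x + y" y] by auto

lemma v_triangle: "v (x + y) \<le> v x + v y"
  using v_add[of x y] v_nonneg[of x] v_nonneg[of y] by linarith

sublocale metric: Metric_space UNIV "\<lambda>x y. v (x - y)"
proof
  show "v (x - z) \<le> v (x - y) + v (y - z)" for x y z
    using v_triangle[of "x - y" "y - z"] by simp
qed (simp_all add: v_diff_commute)

lemma fps_sums_at_iff:
  "fps_sums_at v g z s \<longleftrightarrow> (\<lambda>m. v ((\<Sum>j<m. fps_nth g j * z ^ j) - s)) \<longlonglongrightarrow> 0"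
  unfolding fps_sums_at_def abs_topology_def by (simp add: metric.limitin_metric_dist_null)

lemma fps_value_eq:
  assumes "fps_sums_at v g z s"
  shows "fps_value v g z = s"
  unfolding fps_value_def
proof (rule the_equality)
  show "fps_sums_at v g z s" by (rule assms)
  show "s' = s" if "fps_sums_at v g z s'" for s'
    using metric.limitin_metric_unique[of _ s' sequentially s] that assms
    unfolding fps_sums_at_def abs_topology_def by simp
qed

lemma fps_sums_value: "entire v g \<Longrightarrow> fps_sums_at v g z (fps_value v g z)"
  using fps_value_eq by (auto simp: entire_def)

lemma fps_sums_terms_null:
  assumes "fps_sums_at v g z s"
  shows "(\<lambda>j. v (fps_nth g j) * v z ^ j) \<longlonglongrightarrow> 0"
proof -
  define S where "S = (\<lambda>m. \<Sum>j<m. fps_nth g j * z ^ j)"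
  have lim: "(\<lambda>m. v (S m - s)) \<longlonglongrightarrow> 0" using assms by (simp add: fps_sums_at_iff S_def)
  have "(\<lambda>m. v (S (Suc m) - s) + v (S m - s)) \<longlonglongrightarrow> 0"
    by (intro tendsto_add_zero LIMSEQ_Suc lim)
  moreover have "v (fps_nth g m) * v z ^ m \<le> v (S (Suc m) - s) + v (S m - s)" for m
  proof -
    have "v (fps_nth g m) * v z ^ m = v ((S (Suc m) - s) - (S m - s))"
      by (simp add: S_def v_mult v_power)
    also have "\<dots> \<le> max (v (S (Suc m) - s)) (v (S m - s))" by (rule v_diff)
    also have "\<dots> \<le> v (S (Suc m) - s) + v (S m - s)" by simp
    finally show ?thesis .
  qed
  ultimately show ?thesis
    using null_seq_comparison[of "\<lambda>m. v (S (Suc m) - s) + v (S m - s)" "\<lambda>j. v (fps_nth g j) * v z ^ j"]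
    by simp
qed

text \<open>If some v z exceeds 1, a power of z dominates the radius r, and convergence at that
  power suffices. Otherwise v is trivial, and convergence at 1 leaves only finitely many nonzero
  coefficients.\<close>

lemma entire_terms_null:
  assumes g: "entire v g" and r: "0 \<le> r"
  shows "(\<lambda>j. v (fps_nth g j) * r ^ j) \<longlonglongrightarrow> 0"
proof -
  have null: "(\<lambda>j. v (fps_nth g j) * v z ^ j) \<longlonglongrightarrow> 0" for z
    using fps_sums_terms_null[of g z] g unfolding entire_def by blast
  show ?thesis
  proof (cases "\<exists>z. v z > 1")
    case True
    then obtain z where "v z > 1" ..
    then obtain k where "r < v z ^ k" using real_arch_pow by blast
    then have "r \<le> v (z ^ k)" by (simp add: v_power)
    then have "v (fps_nth g j) * r ^ j \<le> v (fps_nth g j) * v (z ^ k) ^ j" for j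
      using r by (intro mult_left_mono power_mono) auto
    then show ?thesis
      using r by (intro null_seq_comparison[OF null[of "z ^ k"]]) auto
  next
    case False
    have triv: "v x = 1" if "x \<noteq> 0" for x
    proof (rule antisym)
      show "v x \<le> 1" using False by (meson not_less)
      have "v (inverse x) \<le> 1" using False by (meson not_less)
      then show "1 \<le> v x" using that v_nonneg[of x]
        by (simp add: v_inverse inverse_le_1_iff)
    qed
    have "eventually (\<lambda>j. v (fps_nth g j) * v 1 ^ j < 1) sequentially"
      using order_tendstoD(2)[OF null[of 1], of 1] by simp
    then have "eventually (\<lambda>j. v (fps_nth g j) * r ^ j = 0) sequentially"
      by eventually_elim (use triv in force)
    then show ?thesis by (rule tendsto_eventually)
  qed
qed

lemma fps_sums_const: "fps_sums_at v (fps_const c) z c"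
proof -
  have "(\<Sum>j<m. fps_nth (fps_const c) j * z ^ j) = c" if "0 < m" for m
  proof -
    have "(\<Sum>j<m. fps_nth (fps_const c) j * z ^ j) = (\<Sum>j<m. if j = 0 then c else 0)"
      by (intro sum.cong) auto
    then show ?thesis using that by simp
  qed
  then show ?thesis
    unfolding fps_sums_at_iff
    by (intro tendsto_eventually eventually_sequentiallyI[of 1]) auto
qed

lemma fps_sums_add:
  assumes "fps_sums_at v g z s" "fps_sums_at v h z t"
  shows "fps_sums_at v (g + h) z (s + t)"
proof -
  define S where "S = (\<lambda>m. \<Sum>j<m. fps_nth g j * z ^ j)"
  define T where "T = (\<lambda>m. \<Sum>j<m. fps_nth h j * z ^ j)"
  have "(\<lambda>m. v (S m - s)) \<longlonglongrightarrow> 0" "(\<lambda>m. v (T m - t)) \<longlonglongrightarrow> 0"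
    using assms by (simp_all add: fps_sums_at_iff S_def T_def)
  then have "(\<lambda>m. v (S m - s) + v (T m - t)) \<longlonglongrightarrow> 0" by (rule tendsto_add_zero)
  moreover have "v (S m + T m - (s + t)) \<le> v (S m - s) + v (T m - t)" for m
  proof -
    have "v (S m + T m - (s + t)) = v ((S m - s) + (T m - t))" by (simp add: algebra_simps)
    then show ?thesis by (simp only: v_triangle)
  qed
  ultimately have "(\<lambda>m. v (S m + T m - (s + t))) \<longlonglongrightarrow> 0"
    using null_seq_comparison[of _ "\<lambda>m. v (S m + T m - (s + t))"] v_nonneg by blast
  then show ?thesis
    by (simp add: fps_sums_at_iff S_def T_def sum.distrib algebra_simps)
qed

text \<open>The product of the m-th partial sums differs from that of the Cauchy product by the
  terms with i, j < m \<le> i + j. For m \<ge> 2 M one index is at least M, so each term is small,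
  and by the ultrametric inequality so is their sum; no absolute convergence is involved.\<close>

lemma fps_sums_mult:
  assumes "fps_sums_at v g z s" "fps_sums_at v h z t"
  shows "fps_sums_at v (g * h) z (s * t)"
proof -
  define a where "a = (\<lambda>j. fps_nth g j * z ^ j)"
  define b where "b = (\<lambda>j. fps_nth h j * z ^ j)"
  define S where "S = (\<lambda>m. \<Sum>j<m. a j)"
  define T where "T = (\<lambda>m. \<Sum>j<m. b j)"
  define U where "U = (\<lambda>m. \<Sum>j<m. fps_nth (g * h) j * z ^ j)"
  have limS: "(\<lambda>m. v (S m - s)) \<longlonglongrightarrow> 0" and limT: "(\<lambda>m. v (T m - t)) \<longlonglongrightarrow> 0"
    using assms by (simp_all add: fps_sums_at_iff S_def T_def a_def b_def)
  have na: "(\<lambda>j. v (a j)) \<longlonglongrightarrow> 0" and nb: "(\<lambda>j. v (b j)) \<longlonglongrightarrow> 0"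
    using assms[THEN fps_sums_terms_null] by (simp_all add: a_def b_def v_mult v_power)
  obtain A where A: "0 < A" "\<And>j. v (a j) \<le> A" using null_seq_bound[OF na] by blast
  obtain B where B: "0 < B" "\<And>j. v (b j) \<le> B" using null_seq_bound[OF nb] by blast
  have diff: "(\<lambda>m. v (S m * T m - U m)) \<longlonglongrightarrow> 0"
  proof (rule LIMSEQ_I)
    fix e :: real assume e: "0 < e"
    have "eventually (\<lambda>j. v (a j) < e / B) sequentially" "eventually (\<lambda>j. v (b j) < e / A) sequentially"
      using order_tendstoD(2)[OF na, of "e / B"] order_tendstoD(2)[OF nb, of "e / A"] e A B by simp_all
    then have "eventually (\<lambda>j. v (a j) < e / B \<and> v (b j) < e / A) sequentially"
      by (rule eventually_conj)
    then obtain M where M: "\<And>j. j \<ge> M \<Longrightarrow> v (a j) < e / B" "\<And>j. j \<ge> M \<Longrightarrow> v (b j) < e / A"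
      by (auto simp: eventually_sequentially)
    have "v (S m * T m - U m) < e" if m: "m \<ge> 2 * M" for m
    proof -
      define D where "D = {(i, j). i < m \<and> j < m \<and> m \<le> i + j}"
      have pow: "z ^ k = z ^ i * z ^ (k - i)" if "i \<le> k" for i k
        using that by (simp flip: power_add)
      have "U m = (\<Sum>k<m. \<Sum>i\<le>k. a i * b (k - i))"
        unfolding U_def a_def b_def fps_mult_nth sum_distrib_right atLeast0AtMost
        by (intro sum.cong refl) (auto simp: mult_ac pow)
      also have "\<dots> = (\<Sum>(i, j)\<in>{(i, j). i + j < m}. a i * b j)"
        by (rule sum.triangle_reindex[symmetric])
      finally have U: "U m = (\<Sum>(i, j)\<in>{(i, j). i + j < m}. a i * b j)" .
      have "S m * T m = (\<Sum>(i, j)\<in>{..<m} \<times> {..<m}. a i * b j)"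
        unfolding S_def T_def by (simp add: sum_product sum.cartesian_product)
      also have "{..<m} \<times> {..<m} = {(i, j). i + j < m} \<union> D" by (auto simp: D_def)
      also have "(\<Sum>(i, j)\<in>{(i, j). i + j < m} \<union> D. a i * b j) =
          (\<Sum>(i, j)\<in>{(i, j). i + j < m}. a i * b j) + (\<Sum>(i, j)\<in>D. a i * b j)"
      proof (rule sum.union_disjoint)
        show "finite {(i, j). i + j < m}" by (rule finite_subset[of _ "{..<m} \<times> {..<m}"]) auto
        show "finite D" by (rule finite_subset[of _ "{..<m} \<times> {..<m}"]) (auto simp: D_def)
      qed (auto simp: D_def)
      finally have "S m * T m - U m = (\<Sum>(i, j)\<in>D. a i * b j)" by (simp add: U)
      moreover have "v (\<Sum>(i, j)\<in>D. a i * b j) < e"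
      proof (rule v_sum_less[OF e])
        fix x assume "x \<in> D"
        then obtain i j where x: "x = (i, j)" "m \<le> i + j" by (auto simp: D_def)
        then have "i \<ge> M \<or> j \<ge> M" using m by linarith
        then have "v (a i) * v (b j) < e"
        proof
          assume "i \<ge> M"
          then have "v (a i) * v (b j) \<le> v (a i) * B" "v (a i) * B < e"
            using M(1)[of i] B by (auto intro!: mult_left_mono simp: pos_less_divide_eq)
          then show ?thesis by linarith
        next
          assume "j \<ge> M"
          then have "v (a i) * v (b j) \<le> A * v (b j)" "A * v (b j) < e"
            using M(2)[of j] A by (auto intro!: mult_right_mono simp: pos_less_divide_eq mult.commute)
          then show ?thesis by linarith
        qed
        then show "v (case x of (i, j) \<Rightarrow> a i * b j) < e" by (simp add: x v_mult)
      qed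
      ultimately show ?thesis by simp
    qed
    then show "\<exists>no. \<forall>n\<ge>no. norm (v (S n * T n - U n) - 0) < e" by auto
  qed
  have "(\<lambda>m. (v s + v (S m - s)) * v (T m - t) + v (S m - s) * v t + v (S m * T m - U m)) \<longlonglongrightarrow> 0"
    by (rule tendsto_eq_rhs, (rule tendsto_intros limS limT diff)+) simp
  moreover have "v (U m - s * t) \<le> (v s + v (S m - s)) * v (T m - t) + v (S m - s) * v t + v (S m * T m - U m)"
    for m
  proof -
    have "U m - s * t = (S m * (T m - t) + (S m - s) * t) + - (S m * T m - U m)"
      by (simp add: algebra_simps)
    then have "v (U m - s * t) \<le> v (S m) * v (T m - t) + v (S m - s) * v t + v (S m * T m - U m)"
      using v_triangle[of "S m * (T m - t) + (S m - s) * t" "- (S m * T m - U m)"]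
        v_triangle[of "S m * (T m - t)" "(S m - s) * t"] v_minus[of "S m * T m - U m"]
      by (simp only: v_mult)
    moreover have "v (S m) \<le> v s + v (S m - s)" using v_triangle[of s "S m - s"] by simp
    then have "v (S m) * v (T m - t) \<le> (v s + v (S m - s)) * v (T m - t)"
      by (intro mult_right_mono) auto
    ultimately show ?thesis by linarith
  qed
  ultimately have "(\<lambda>m. v (U m - s * t)) \<longlonglongrightarrow> 0"
    using null_seq_comparison[of _ "\<lambda>m. v (U m - s * t)"] v_nonneg by blast
  then show ?thesis by (simp add: fps_sums_at_iff U_def)
qed

lemma fps_sums_sum:
  "(\<And>i. i \<in> I \<Longrightarrow> fps_sums_at v (g i) z (s i)) \<Longrightarrow> fps_sums_at v (sum g I) z (sum s I)"
  using fps_sums_const[of 0]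
  by (induction I rule: infinite_finite_induct) (auto intro: fps_sums_add)

lemma fps_sums_power: "fps_sums_at v g z s \<Longrightarrow> fps_sums_at v (g ^ n) z (s ^ n)"
  using fps_sums_const[of 1] by (induction n) (auto intro: fps_sums_mult)

lemma fps_sums_prod:
  "(\<And>i. i \<in> I \<Longrightarrow> fps_sums_at v (g i) z (s i)) \<Longrightarrow> fps_sums_at v (prod g I) z (prod s I)"
  using fps_sums_const[of 1]
  by (induction I rule: infinite_finite_induct) (auto intro: fps_sums_mult)

lemma fps_sums_form_comp:
  fixes F :: "'a fps ^ 'N::finite" and x :: "'a ^ 'N"
  assumes "\<And>i. fps_sums_at v (F $ i) z (x $ i)"
  shows "fps_sums_at v (form_comp P F) z (mpoly_subst (\<lambda>c. c) P x)"
  unfolding form_comp_def mpoly_subst_def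
  by (intro fps_sums_sum fps_sums_mult fps_sums_prod fps_sums_power fps_sums_const assms)

lemma entire_const: "entire v (fps_const c)"
  using fps_sums_const by (auto simp: entire_def)

lemma entire_one: "entire v 1"
  using entire_const[of 1] by simp

lemma entire_mult: "entire v g \<Longrightarrow> entire v h \<Longrightarrow> entire v (g * h)"
  unfolding entire_def using fps_sums_mult by blast

lemma entire_add: "entire v g \<Longrightarrow> entire v h \<Longrightarrow> entire v (g + h)"
  unfolding entire_def using fps_sums_add by blast

lemma entire_sum: "(\<And>i. i \<in> I \<Longrightarrow> entire v (g i)) \<Longrightarrow> entire v (sum g I)"
  using entire_const[of 0] by (induction I rule: infinite_finite_induct) (auto intro: entire_add)

lemma entire_power: "entire v g \<Longrightarrow> entire v (g ^ n)"
  by (induction n) (auto intro: entire_mult entire_one)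

lemma entire_prod: "(\<And>i. i \<in> I \<Longrightarrow> entire v (g i)) \<Longrightarrow> entire v (prod g I)"
  by (induction I rule: infinite_finite_induct) (auto intro: entire_mult entire_one)

lemma entire_form_comp:
  fixes F :: "'a fps ^ 'N::finite"
  shows "(\<And>i. entire v (F $ i)) \<Longrightarrow> entire v (form_comp P F)"
  unfolding form_comp_def mpoly_subst_def
  by (intro entire_sum entire_mult entire_prod entire_power entire_const)


section \<open>The Gauss norm\<close>

text \<open>The terms tend to 0, so the supremum is taken over a bounded set; without boundedness a
  real \<open>SUP\<close> carries no information.\<close>

lemma gauss_norm_upper:
  assumes "entire v g" "0 \<le> r"
  shows "v (fps_nth g j) * r ^ j \<le> gauss_norm v r g"
proof -
  obtain B where "\<And>j. v (fps_nth g j) * r ^ j \<le> B"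
    using null_seq_bound[OF entire_terms_null[OF assms]] by blast
  then have "bdd_above (range (\<lambda>j. v (fps_nth g j) * r ^ j))" by (auto simp: bdd_above_def)
  then show ?thesis unfolding gauss_norm_def by (intro cSUP_upper) auto
qed

lemma gauss_norm_le: "(\<And>j. v (fps_nth g j) * r ^ j \<le> B) \<Longrightarrow> gauss_norm v r g \<le> B"
  unfolding gauss_norm_def by (intro cSUP_least) auto

lemma gauss_norm_nonneg: "entire v g \<Longrightarrow> 0 \<le> r \<Longrightarrow> 0 \<le> gauss_norm v r g"
  using order_trans[OF v_nonneg[of "fps_nth g 0"]] gauss_norm_upper[of g r 0] by simp

lemma gauss_norm_pos:
  assumes "entire v g" "0 < r" "g \<noteq> 0"
  shows "0 < gauss_norm v r g"
proof -
  obtain j where "fps_nth g j \<noteq> 0" using assms(3) by (auto simp: fps_eq_iff)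
  then have "0 < v (fps_nth g j) * r ^ j" using assms(2) by simp
  also have "\<dots> \<le> gauss_norm v r g" using assms by (intro gauss_norm_upper) auto
  finally show ?thesis .
qed

lemma gauss_norm_mono:
  assumes "entire v g" "0 \<le> r" "r \<le> r'"
  shows "gauss_norm v r g \<le> gauss_norm v r' g"
proof (rule gauss_norm_le)
  fix j
  have "v (fps_nth g j) * r ^ j \<le> v (fps_nth g j) * r' ^ j"
    using assms by (intro mult_left_mono power_mono) auto
  also have "\<dots> \<le> gauss_norm v r' g" using assms by (intro gauss_norm_upper) auto
  finally show "v (fps_nth g j) * r ^ j \<le> gauss_norm v r' g" .
qed

text \<open>Since the terms tend to 0, only finitely many compete for the supremum, so it is
  attained. Taking the least such index makes all earlier terms strictly smaller, as Gauss's lemma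
  requires.\<close>

lemma gauss_norm_first_max:
  assumes g: "entire v g" "0 < r" "g \<noteq> 0"
  obtains i where "v (fps_nth g i) * r ^ i = gauss_norm v r g"
    "\<And>j. j < i \<Longrightarrow> v (fps_nth g j) * r ^ j < gauss_norm v r g"
proof -
  let ?t = "\<lambda>j. v (fps_nth g j) * r ^ j"
  let ?M = "gauss_norm v r g"
  have pos: "0 < ?M" using g by (rule gauss_norm_pos)
  have "\<exists>i. ?t i = ?M"
  proof (rule ccontr)
    assume no: "\<not> ?thesis"
    have less: "?t j < ?M" for j using no gauss_norm_upper[OF g(1), of r j] g(2) by (metis less_le)
    have "eventually (\<lambda>j. ?t j < ?M / 2) sequentially"
      using order_tendstoD(2)[OF entire_terms_null[OF g(1)], of r "?M / 2"] g pos by simp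
    then obtain k where k: "\<And>j. j \<ge> k \<Longrightarrow> ?t j < ?M / 2" by (auto simp: eventually_sequentially)
    define B where "B = Max (insert (?M / 2) (?t ` {..<k}))"
    have "B < ?M" unfolding B_def using pos less by (subst Max_less_iff) auto
    moreover have "?t j \<le> B" for j
    proof (cases "j < k")
      case True
      then show ?thesis unfolding B_def by (intro Max_ge) auto
    next
      case False
      then have "?t j \<le> ?M / 2" using k[of j] by simp
      also have "\<dots> \<le> B" unfolding B_def by (intro Max_ge) auto
      finally show ?thesis .
    qed
    then have "?M \<le> B" by (rule gauss_norm_le)
    ultimately show False by simp
  qed
  then have 1: "?t (LEAST i. ?t i = ?M) = ?M" by (rule LeastI_ex)
  have "?t j < ?M" if "j < (LEAST i. ?t i = ?M)" for j
    using not_less_Least[OF that] gauss_norm_upper[OF g(1), of r j] g(2) by (simp add: less_le)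
  with 1 show ?thesis by (rule that)
qed

lemma gauss_norm_zero: "gauss_norm v r 0 = 0"
  by (simp add: gauss_norm_def)

lemma gauss_norm_mult_le:
  assumes "entire v g" "entire v h" "0 \<le> r"
  shows "gauss_norm v r (g * h) \<le> gauss_norm v r g * gauss_norm v r h"
proof (rule gauss_norm_le)
  fix n
  define M where "M = gauss_norm v r g * gauss_norm v r h"
  have M0: "0 \<le> M" unfolding M_def using assms by (intro mult_nonneg_nonneg gauss_norm_nonneg)
  have term_le: "v (fps_nth g i) * v (fps_nth h (n - i)) * r ^ n \<le> M" if "i \<le> n" for i
  proof -
    have "v (fps_nth g i) * v (fps_nth h (n - i)) * r ^ n =
        (v (fps_nth g i) * r ^ i) * (v (fps_nth h (n - i)) * r ^ (n - i))"
      using that by (simp add: mult_ac flip: power_add)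
    also have "\<dots> \<le> M" unfolding M_def
      using assms by (intro mult_mono gauss_norm_upper gauss_norm_nonneg mult_nonneg_nonneg) auto
    finally show ?thesis .
  qed
  show "v (fps_nth (g * h) n) * r ^ n \<le> M"
  \<comment> \<open>The power vanishes when r = 0 and n > 0; the estimate cannot be divided by it
    then, but is trivial.\<close>
  proof (cases "r ^ n = 0")
    case False
    then have rn: "0 < r ^ n" using assms(3) by (metis less_le zero_le_power)
    have "v (fps_nth (g * h) n) \<le> M / r ^ n"
      unfolding fps_mult_nth
      using term_le rn M0 by (intro v_sum_le) (auto simp: v_mult pos_le_divide_eq)
    then show ?thesis using rn by (simp add: pos_le_divide_eq)
  qed (simp only: mult_zero_right M0)
qed

text \<open>Gauss's lemma: if \<open>i\<close> and \<open>l\<close> are the first indices at which the norms of the factors are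
  attained, then a single summand dominates the coefficient of the product at \<open>i + l\<close>.\<close>

lemma gauss_norm_mult:
  assumes "entire v g" "entire v h" "0 < r"
  shows "gauss_norm v r (g * h) = gauss_norm v r g * gauss_norm v r h"
proof (cases "g = 0 \<or> h = 0")
  case True
  then show ?thesis by (auto simp: gauss_norm_zero)
next
  case False
  let ?G = "gauss_norm v r g" and ?H = "gauss_norm v r h"
  obtain i where i: "v (fps_nth g i) * r ^ i = ?G" "\<And>j. j < i \<Longrightarrow> v (fps_nth g j) * r ^ j < ?G"
    using gauss_norm_first_max[of g r] assms False by blast
  obtain l where l: "v (fps_nth h l) * r ^ l = ?H" "\<And>j. j < l \<Longrightarrow> v (fps_nth h j) * r ^ j < ?H"
    using gauss_norm_first_max[of h r] assms False by blast
  have pos: "0 < ?G" "0 < ?H" using assms False gauss_norm_pos by auto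
  define rest where "rest = (\<Sum>j\<in>{0..i+l} - {i}. fps_nth g j * fps_nth h (i + l - j))"
  have split: "fps_nth (g * h) (i + l) = fps_nth g i * fps_nth h l + rest"
    unfolding fps_mult_nth rest_def by (subst sum.remove[of _ i]) auto
  have rl: "0 < r ^ (i + l)" using assms by simp
  have lead: "v (fps_nth g i * fps_nth h l) = ?G * ?H / r ^ (i + l)"
    using assms by (simp add: i(1)[symmetric] l(1)[symmetric] v_mult power_add)
  have "v rest < ?G * ?H / r ^ (i + l)"
    unfolding rest_def
  proof (rule v_sum_less)
    show "0 < ?G * ?H / r ^ (i + l)" using pos rl by simp
    fix j assume "j \<in> {0..i+l} - {i}"
    then have j: "j \<le> i + l" "j \<noteq> i" by auto
    let ?k = "i + l - j"
    have "(v (fps_nth g j) * r ^ j) * (v (fps_nth h ?k) * r ^ ?k) < ?G * ?H"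
    \<comment> \<open>The indices j and \<open>?k\<close> add up to i + l and j \<noteq> i, so
      either j < i or \<open>?k\<close> < l: one of the two factors is strictly below its
      norm.\<close>
    proof (cases "j < i")
      case True
      have "(v (fps_nth g j) * r ^ j) * (v (fps_nth h ?k) * r ^ ?k) \<le> (v (fps_nth g j) * r ^ j) * ?H"
        using gauss_norm_upper[of h r ?k] assms by (intro mult_left_mono) auto
      also have "\<dots> < ?G * ?H" using i(2)[OF True] pos by simp
      finally show ?thesis .
    next
      case False
      then have "?k < l" using j by linarith
      have "(v (fps_nth g j) * r ^ j) * (v (fps_nth h ?k) * r ^ ?k) \<le> ?G * (v (fps_nth h ?k) * r ^ ?k)"
        using gauss_norm_upper[of g r j] assms by (intro mult_right_mono) auto
      also have "\<dots> < ?G * ?H" using l(2)[OF \<open>?k < l\<close>] pos by simp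
      finally show ?thesis .
    qed
    also have "(v (fps_nth g j) * r ^ j) * (v (fps_nth h ?k) * r ^ ?k) =
        v (fps_nth g j * fps_nth h ?k) * r ^ (i + l)"
      using j by (simp add: v_mult mult_ac flip: power_add)
    finally show "v (fps_nth g j * fps_nth h ?k) < ?G * ?H / r ^ (i + l)"
      using rl by (simp add: pos_less_divide_eq)
  qed
  then have "v (fps_nth (g * h) (i + l)) = ?G * ?H / r ^ (i + l)"
    unfolding split using lead v_add_eq[of rest "fps_nth g i * fps_nth h l"] by simp
  then have "?G * ?H = v (fps_nth (g * h) (i + l)) * r ^ (i + l)" using assms(3) by simp
  also have "\<dots> \<le> gauss_norm v r (g * h)"
    using assms by (intro gauss_norm_upper entire_mult) auto
  finally show ?thesis using gauss_norm_mult_le[of g h r] assms by simp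
qed

lemma gauss_norm_const: "0 \<le> r \<Longrightarrow> gauss_norm v r (fps_const c) = v c"
proof (rule antisym)
  show "gauss_norm v r (fps_const c) \<le> v c"
    by (rule gauss_norm_le) simp
  show "v c \<le> gauss_norm v r (fps_const c)" if "0 \<le> r"
    using gauss_norm_upper[OF entire_const that, of c 0] by simp
qed

lemma gauss_norm_power: "entire v g \<Longrightarrow> 0 < r \<Longrightarrow> gauss_norm v r (g ^ n) = gauss_norm v r g ^ n"
  using gauss_norm_const[of r 1]
  by (induction n) (simp_all add: gauss_norm_mult entire_power)

lemma gauss_norm_prod:
  "(\<And>i. i \<in> I \<Longrightarrow> entire v (g i)) \<Longrightarrow> 0 < r \<Longrightarrow>
    gauss_norm v r (prod g I) = (\<Prod>i\<in>I. gauss_norm v r (g i))"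
  using gauss_norm_const[of r 1]
  by (induction I rule: infinite_finite_induct) (simp_all add: gauss_norm_mult entire_prod)

lemma gauss_norm_sum_le:
  assumes "\<And>i. i \<in> I \<Longrightarrow> entire v (g i)" "\<And>i. i \<in> I \<Longrightarrow> gauss_norm v r (g i) \<le> B" "0 \<le> B" "0 < r"
  shows "gauss_norm v r (sum g I) \<le> B"
proof (rule gauss_norm_le)
  fix j
  have rj: "0 < r ^ j" using assms by simp
  have "v (fps_nth (g i) j) \<le> B / r ^ j" if "i \<in> I" for i
    using gauss_norm_upper[OF assms(1)[OF that], of r j] assms(2)[OF that] assms(4) rj
    by (simp add: pos_le_divide_eq)
  then have "v (fps_nth (sum g I) j) \<le> B / r ^ j"
    unfolding fps_sum_nth using assms rj by (intro v_sum_le) auto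
  then show "v (fps_nth (sum g I) j) * r ^ j \<le> B" using rj by (simp add: pos_le_divide_eq)
qed

end

text \<open>If the field has nonzero elements of value below 1, the lowest nonzero term dominates
  near 0. If it has none, g is a polynomial, and a nonzero polynomial has a non-root.\<close>

lemma entire_eq_zero:
  fixes v :: "'a::alg_closed_field \<Rightarrow> real"
  assumes "nonarch_abs v" and g: "entire v g" and zero: "\<And>z. fps_value v g z = 0"
  shows "g = 0"
proof (rule ccontr)
  interpret nonarch_field v by standard (rule assms)
  assume "g \<noteq> 0"
  define k where "k = subdegree g"
  have gk: "fps_nth g k \<noteq> 0" using \<open>g \<noteq> 0\<close> by (simp add: k_def)
  have lim: "(\<lambda>m. v (\<Sum>j<m. fps_nth g j * z ^ j)) \<longlonglongrightarrow> 0" for z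
    using fps_sums_value[OF g, of z] by (simp add: fps_sums_at_iff zero)
  show False
  proof (cases "\<exists>w. w \<noteq> 0 \<and> v w < 1")
    case True
    then obtain w where w: "w \<noteq> 0" "v w < 1" by blast
    obtain B where B: "0 < B" "\<And>j. v (fps_nth g j) * 1 ^ j \<le> B"
      using null_seq_bound[OF entire_terms_null[OF g, of 1]] by auto
    have "0 < v (fps_nth g k) / B" using gk B by simp
    then obtain n where n: "v w ^ n < v (fps_nth g k) / B" using real_arch_pow_inv w(2) by blast
    \<comment> \<open>B bounds all coefficients, and n makes B v z smaller than the value of the
      lowest coefficient, so every higher term at z is strictly smaller than the lowest one. The
      successor ensures v z \<le> v w ^ n while z stays a positive power of w.\<close>
    define z where "z = w ^ Suc n"
    have z: "0 < v z" "v z \<le> 1" "v z < v (fps_nth g k) / B"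
    proof -
      have vw: "0 < v w" using w(1) by simp
      then show "0 < v z" by (simp add: z_def v_power v_mult)
      show "v z \<le> 1" using w vw by (simp add: z_def v_power v_mult power_le_one mult_le_one)
      have "v z \<le> v w ^ n" using w vw by (simp add: z_def v_power v_mult mult_le_cancel_right1)
      with n show "v z < v (fps_nth g k) / B" by linarith
    qed
    define c where "c = v (fps_nth g k) * v z ^ k"
    have c: "0 < c" using gk z by (simp add: c_def)
    have "v (\<Sum>j<m. fps_nth g j * z ^ j) = c" if m: "m > k" for m
    proof -
      define rest where "rest = (\<Sum>j\<in>{..<m} - {k}. fps_nth g j * z ^ j)"
      have "v rest < c"
        unfolding rest_def
      proof (rule v_sum_less[OF c])
        fix j assume "j \<in> {..<m} - {k}"
        then consider "j < k" | "j > k" by fastforce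
        then show "v (fps_nth g j * z ^ j) < c"
        proof cases
          case 1
          then have "fps_nth g j = 0" unfolding k_def by (rule nth_less_subdegree_zero)
          then show ?thesis using c by simp
        next
          case 2
          then have "v z ^ j \<le> v z ^ Suc k" using z by (intro power_decreasing) auto
          then have "v (fps_nth g j) * v z ^ j \<le> B * v z ^ Suc k"
            using B z by (intro mult_mono) auto
          also have "\<dots> = (B * v z) * v z ^ k" by simp
          also have "\<dots> < c" unfolding c_def
            using z B by (intro mult_strict_right_mono) (auto simp: pos_less_divide_eq mult.commute)
          finally show ?thesis by (simp add: v_mult v_power)
        qed
      qed
      moreover have "(\<Sum>j<m. fps_nth g j * z ^ j) = fps_nth g k * z ^ k + rest"
        unfolding rest_def using m by (subst sum.remove[of _ k]) auto
      ultimately show ?thesis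
        using v_add_eq[of rest "fps_nth g k * z ^ k"] by (simp add: c_def v_mult v_power)
    qed
    then have "(\<lambda>m. v (\<Sum>j<m. fps_nth g j * z ^ j)) \<longlonglongrightarrow> c"
      by (intro tendsto_eventually eventually_sequentiallyI[of "Suc k"]) auto
    with lim[of z] c show False using LIMSEQ_unique by fastforce
  next
    case False
    have big: "1 \<le> v x" if "x \<noteq> 0" for x using False that by (meson not_less)
    have "eventually (\<lambda>j. v (fps_nth g j) * 1 ^ j < 1) sequentially"
      using order_tendstoD(2)[OF entire_terms_null[OF g, of 1], of 1] by simp
    then obtain M where M: "\<And>j. j \<ge> M \<Longrightarrow> v (fps_nth g j) < 1" by (auto simp: eventually_sequentially)
    then have gM: "fps_nth g j = 0" if "j \<ge> M" for j using big that by (meson not_less)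
    define p where "p = (\<Sum>j<M. monom (fps_nth g j) j)"
    have "k < M" using gM gk by (meson not_less)
    then have "coeff p k \<noteq> 0" using gk by (simp add: p_def coeff_sum)
    then have "p \<noteq> 0" by auto
    then obtain z where z: "poly p z \<noteq> 0" using nonroot_exists by blast
    have "(\<Sum>j<m. fps_nth g j * z ^ j) = poly p z" if "m \<ge> M" for m
    proof -
      have "poly p z = (\<Sum>j<M. fps_nth g j * z ^ j)" by (simp add: p_def poly_sum poly_monom)
      also have "\<dots> = (\<Sum>j<m. fps_nth g j * z ^ j)"
        using that gM by (intro sum.mono_neutral_left) auto
      finally show ?thesis ..
    qed
    then have "(\<lambda>m. v (\<Sum>j<m. fps_nth g j * z ^ j)) \<longlonglongrightarrow> v (poly p z)"
      by (intro tendsto_eventually eventually_sequentiallyI[of M]) auto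
    with lim[of z] z show False using LIMSEQ_unique v_eq_0 by metis
  qed
qed


section \<open>Forms\<close>

text \<open>Substituting \<open>t x\<close> for \<open>x\<close>, with \<open>t\<close> a new variable, separates the homogeneous parts.\<close>

lemma coeff_mpoly_subst_graded:
  fixes x :: "'b::comm_ring_1 ^ 'N::finite"
  shows "coeff (mpoly_subst (\<lambda>c. [:h c:]) P (\<chi> j. monom (x $ j) 1)) e =
    (\<Sum>m | m \<in> Poly_Mapping.keys P \<and> (\<Sum>i\<in>UNIV. Poly_Mapping.lookup m i) = e.
       h (Poly_Mapping.lookup P m) * (\<Prod>i\<in>UNIV. (x $ i) ^ Poly_Mapping.lookup m i))"
proof -
  have mon: "(\<Prod>i\<in>I. monom (x $ i) 1 ^ m i) = monom (\<Prod>i\<in>I. (x $ i) ^ m i) (\<Sum>i\<in>I. m i)"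
    for I :: "'N set" and m
    by (induction I rule: infinite_finite_induct) (simp_all add: monom_power mult_monom)
  have "coeff (mpoly_subst (\<lambda>c. [:h c:]) P (\<chi> j. monom (x $ j) 1)) e =
    (\<Sum>m\<in>Poly_Mapping.keys P. if (\<Sum>i\<in>UNIV. Poly_Mapping.lookup m i) = e
       then h (Poly_Mapping.lookup P m) * (\<Prod>i\<in>UNIV. (x $ i) ^ Poly_Mapping.lookup m i) else 0)"
    unfolding mpoly_subst_def coeff_sum vec_lambda_beta mon
    by (intro sum.cong refl) simp
  then show ?thesis by (simp add: sum.inter_filter)
qed

lemma form_subst_graded:
  fixes x :: "'b::comm_ring_1 ^ 'N::finite"
  assumes "is_form d P"
  shows "mpoly_subst (\<lambda>c. [:h c:]) P (\<chi> j. monom (x $ j) 1) = monom (mpoly_subst h P x) d"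
proof (rule poly_eqI)
  fix e
  have keys: "{m. m \<in> Poly_Mapping.keys P \<and> (\<Sum>i\<in>UNIV. Poly_Mapping.lookup m i) = e} =
      (if e = d then Poly_Mapping.keys P else {})"
    using assms by (auto simp: is_form_def)
  show "coeff (mpoly_subst (\<lambda>c. [:h c:]) P (\<chi> j. monom (x $ j) 1)) e = coeff (monom (mpoly_subst h P x) d) e"
    unfolding coeff_mpoly_subst_graded keys by (simp add: mpoly_subst_def)
qed

lemma form_subst_scale:
  fixes x :: "'a::field ^ 'N::finite"
  assumes "is_form d P"
  shows "mpoly_subst (\<lambda>c. c) P (c *s x) = c ^ d * mpoly_subst (\<lambda>c. c) P x"
  unfolding mpoly_subst_def sum_distrib_left
proof (rule sum.cong)
  fix m assume "m \<in> Poly_Mapping.keys P"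
  then have "d = (\<Sum>i\<in>UNIV. Poly_Mapping.lookup m i)" using assms by (simp add: is_form_def)
  then show "Poly_Mapping.lookup P m * (\<Prod>i\<in>UNIV. ((c *s x) $ i) ^ Poly_Mapping.lookup m i) =
      c ^ d * (Poly_Mapping.lookup P m * (\<Prod>i\<in>UNIV. (x $ i) ^ Poly_Mapping.lookup m i))"
    by (simp add: power_mult_distrib prod.distrib power_sum)
qed simp

text \<open>The lower bound below returns a form together with some degree of it; this identifies
  that degree with the given degree of the hypersurface.\<close>

lemma is_form_unique: "is_form d P \<Longrightarrow> is_form e P \<Longrightarrow> P \<noteq> 0 \<Longrightarrow> d = e"
  by (metis is_form_def keys_eq_empty equals0I)

lemma vanishes_at_proj_point:
  assumes "is_form d P"
  shows "vanishes_at P (proj_point x) \<longleftrightarrow> mpoly_subst (\<lambda>c. c) P x = 0"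
proof
  have "x \<in> proj_point x" unfolding proj_point_def by (auto intro: exI[of _ 1])
  then show "mpoly_subst (\<lambda>c. c) P x = 0" if "vanishes_at P (proj_point x)"
    using that by (auto simp: vanishes_at_def)
  show "vanishes_at P (proj_point x)" if "mpoly_subst (\<lambda>c. c) P x = 0"
    using that form_subst_scale[OF assms] by (auto simp: vanishes_at_def proj_point_def)
qed


section \<open>A uniform lower bound for forms without common zeros\<close>

context nonarch_field
begin

lemma curve_norm_ge: "gauss_norm v r (F $ i) \<le> curve_norm v r F"
  unfolding curve_norm_def by (intro Max_ge) auto

text \<open>Controls the cofactors of the Nullstellensatz identity, which need not be homogeneous:
  each homogeneous part has the growth of its own degree. The constant is crude but depends neither
  on e nor on r.\<close>

lemma gauss_norm_graded_part:
  fixes F :: "'a fps ^ 'N::finite"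
  assumes F: "\<And>i. entire v (F $ i)" and r: "0 < r"
  shows "gauss_norm v r (coeff (mpoly_subst (\<lambda>c. [:fps_const c:]) P (\<chi> j. monom (F $ j) 1)) e)
           \<le> (\<Sum>m\<in>Poly_Mapping.keys P. v (Poly_Mapping.lookup P m)) * curve_norm v r F ^ e"
    (is "_ \<le> ?C * ?M ^ e")
    and "entire v (coeff (mpoly_subst (\<lambda>c. [:fps_const c:]) P (\<chi> j. monom (F $ j) 1)) e)"
proof -
  have C: "0 \<le> ?C" by (intro sum_nonneg) simp
  have M: "0 \<le> ?M" using gauss_norm_nonneg[OF F, of r] curve_norm_ge[of r F] r
    by (meson less_imp_le order_trans)
  let ?t = "\<lambda>m. fps_const (Poly_Mapping.lookup P m) * (\<Prod>i\<in>UNIV. (F $ i) ^ Poly_Mapping.lookup m i)"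
  have ent: "entire v (?t m)" for m
    by (intro entire_mult entire_prod entire_power entire_const F)
  have "gauss_norm v r (?t m) \<le> ?C * ?M ^ e"
    if m: "m \<in> Poly_Mapping.keys P" "(\<Sum>i\<in>UNIV. Poly_Mapping.lookup m i) = e" for m
  proof -
    have "gauss_norm v r (?t m) =
        v (Poly_Mapping.lookup P m) * (\<Prod>i\<in>UNIV. gauss_norm v r (F $ i) ^ Poly_Mapping.lookup m i)"
      using r F by (simp add: gauss_norm_mult gauss_norm_prod gauss_norm_power gauss_norm_const
          entire_prod entire_power entire_const)
    also have "\<dots> \<le> ?C * (\<Prod>i\<in>UNIV. ?M ^ Poly_Mapping.lookup m i)"
    proof (intro mult_mono prod_mono conjI power_mono curve_norm_ge C)
      show "v (Poly_Mapping.lookup P m) \<le> ?C" using m by (intro member_le_sum) auto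
    qed (use F r gauss_norm_nonneg in \<open>auto intro!: prod_nonneg\<close>)
    also have "(\<Prod>i\<in>UNIV. ?M ^ Poly_Mapping.lookup m i) = ?M ^ e"
      unfolding m(2)[symmetric] by (rule power_sum[symmetric])
    finally show ?thesis .
  qed
  then show "gauss_norm v r (coeff (mpoly_subst (\<lambda>c. [:fps_const c:]) P (\<chi> j. monom (F $ j) 1)) e)
           \<le> ?C * ?M ^ e"
    unfolding coeff_mpoly_subst_graded using C M r ent by (intro gauss_norm_sum_le) auto
  show "entire v (coeff (mpoly_subst (\<lambda>c. [:fps_const c:]) P (\<chi> j. monom (F $ j) 1)) e)"
    unfolding coeff_mpoly_subst_graded by (intro entire_sum ent)
qed

lemma gauss_norm_sum_ge:
  assumes "finite I" "\<And>i. i \<in> I \<Longrightarrow> entire v (g i)" "0 < r" "0 < B" "B \<le> gauss_norm v r (sum g I)"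
  shows "\<exists>i\<in>I. B \<le> gauss_norm v r (g i)"
proof (rule ccontr)
  assume no: "\<not> ?thesis"
  \<comment> \<open>Including 0 keeps the maximum meaningful for empty I and makes b a nonnegative
    bound.\<close>
  define b where "b = Max (insert 0 ((\<lambda>i. gauss_norm v r (g i)) ` I))"
  have "b < B" unfolding b_def using assms(1,4) no by (subst Max_less_iff) (auto simp: not_le)
  moreover have "gauss_norm v r (sum g I) \<le> b"
    using assms(1-3) by (intro gauss_norm_sum_le) (auto simp: b_def)
  ultimately show False using assms(5) by simp
qed

end

text \<open>At radii where coordinate k attains the norm of the curve, the K-th power of that norm
  is the norm of a sum over g, so one summand is at least as large. Dividing by the growth of its
  cofactor leaves exactly the degree of g as exponent.\<close>

lemma forms_lower_bound_at:
  fixes v :: "'a::alg_closed_field \<Rightarrow> real" and F :: "'a fps ^ 'N::finite"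
    and T :: "('a, 'N) mpoly set"
  assumes "nonarch_abs v" and F: "\<And>i. entire v (F $ i)"
    and T: "\<And>g. g \<in> T \<Longrightarrow> \<exists>d. is_form d g"
    and zeros: "\<And>x. (\<And>g. g \<in> T \<Longrightarrow> mpoly_subst (\<lambda>c. c) g x = 0) \<Longrightarrow> x $ k = 0"
  shows "\<exists>c>0. \<forall>r>0. gauss_norm v r (F $ k) = curve_norm v r F \<longrightarrow> 0 < curve_norm v r F \<longrightarrow>
    (\<exists>g\<in>T. \<exists>d. is_form d g \<and> c * curve_norm v r F ^ d \<le> gauss_norm v r (form_comp g F))"
proof -
  interpret nonarch_field v by standard (rule assms)
  interpret ideal: module "(*) :: ('a, 'N) mpoly \<Rightarrow> _ \<Rightarrow> _" by (rule module_times)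
  have "\<exists>K. (mpoly_var k :: ('a, 'N) mpoly) ^ K \<in> ideal.span T"
  proof (rule nullstellensatz)
    fix x assume "\<And>g. g \<in> T \<Longrightarrow> mpoly_subst (\<lambda>c. c) g x = 0"
    then have "x $ k = 0" by (rule zeros)
    then show "mpoly_subst (\<lambda>c. c) (mpoly_var k) x = 0" by (simp add: mpoly_subst_var)
  qed
  then obtain K G a where G: "finite G" "G \<subseteq> T" and
    eq: "(mpoly_var k :: ('a, 'N) mpoly) ^ K = (\<Sum>g\<in>G. a g * g)"
    unfolding ideal.span_explicit by blast
  \<comment> \<open>Composition with t F for a new variable t: a ring homomorphism whose coefficient
    at t^e is the composition of the part of degree e.\<close>
  define \<Phi> where "\<Phi> = (\<lambda>P. mpoly_subst (\<lambda>c. [:fps_const c:]) P (\<chi> j. monom (F $ j) 1))"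
  define \<delta> where "\<delta> = (\<lambda>g :: ('a, 'N) mpoly. SOME d. is_form d g)"
  have \<delta>: "is_form (\<delta> g) g" if "g \<in> T" for g
    unfolding \<delta>_def using T[OF that] by (rule someI_ex)
  have hom: "\<Phi> (P * Q) = \<Phi> P * \<Phi> Q" "\<Phi> (P ^ n) = \<Phi> P ^ n" "\<Phi> (sum u I) = (\<Sum>i\<in>I. \<Phi> (u i))"
    for P Q n u and I :: "('a, 'N) mpoly set"
    unfolding \<Phi>_def
    by (rule mpoly_subst_mult mpoly_subst_power mpoly_subst_sum;
        simp add: fps_const_add[symmetric] fps_const_mult[symmetric] one_pCons del: fps_const_add fps_const_mult)+
  \<comment> \<open>The coefficient of degree K in the image of \<open>a g * g\<close>. A form of
    degree above K contributes nothing to it, which the natural-number subtraction would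
    hide.\<close>
  define t where
    "t = (\<lambda>g. if K < \<delta> g then 0 else form_comp g F * coeff (\<Phi> (a g)) (K - \<delta> g))"
  have "(F $ k) ^ K = coeff (\<Phi> (mpoly_var k ^ K)) K"
    unfolding hom by (simp add: \<Phi>_def mpoly_subst_var monom_power one_pCons)
  also have "\<dots> = (\<Sum>g\<in>G. coeff (\<Phi> g * \<Phi> (a g)) K)"
    unfolding eq hom by (simp add: coeff_sum mult.commute)
  also have "\<dots> = (\<Sum>g\<in>G. t g)"
  proof (rule sum.cong)
    fix g assume "g \<in> G"
    then have "\<Phi> g = monom (form_comp g F) (\<delta> g)"
      using \<delta> G unfolding \<Phi>_def form_comp_def by (intro form_subst_graded) auto
    then show "coeff (\<Phi> g * \<Phi> (a g)) K = t g" by (simp add: coeff_monom_mult t_def)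
  qed simp
  finally have sum: "(F $ k) ^ K = (\<Sum>g\<in>G. t g)" .
  define Ca where "Ca = (\<lambda>g. \<Sum>m\<in>Poly_Mapping.keys (a g). v (Poly_Mapping.lookup (a g) m))"
  \<comment> \<open>The summand 1 keeps C positive even if all cofactors vanish.\<close>
  define C where "C = 1 + (\<Sum>g\<in>G. Ca g)"
  have Ca: "0 \<le> Ca g" for g unfolding Ca_def by (intro sum_nonneg) simp
  then have C: "0 < C" unfolding C_def by (intro add_pos_nonneg sum_nonneg) auto
  have ent: "entire v (t g)" for g
    using entire_const[of 0] gauss_norm_graded_part(2)[OF F, of 1] entire_form_comp[OF F]
    by (auto simp: t_def \<Phi>_def intro: entire_mult)
  show ?thesis
  proof (intro exI[of _ "1 / C"] conjI allI impI)
    show "0 < 1 / C" using C by simp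
    fix r :: real
    assume r: "0 < r" and k: "gauss_norm v r (F $ k) = curve_norm v r F" and M: "0 < curve_norm v r F"
    let ?M = "curve_norm v r F"
    have "gauss_norm v r (\<Sum>g\<in>G. t g) = ?M ^ K"
      unfolding sum[symmetric] using r F k by (simp add: gauss_norm_power)
    then obtain g where g: "g \<in> G" "?M ^ K \<le> gauss_norm v r (t g)"
      using gauss_norm_sum_ge[of G t r "?M ^ K"] G ent r M by auto
    have "\<not> K < \<delta> g"
    proof
      assume "K < \<delta> g"
      then have "?M ^ K \<le> 0" using g(2) by (simp add: t_def gauss_norm_zero)
      moreover have "0 < ?M ^ K" using M by simp
      ultimately show False by linarith
    qed
    then have d: "\<delta> g \<le> K" by simp
    have nonneg: "0 \<le> gauss_norm v r (form_comp g F)"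
      using r by (intro gauss_norm_nonneg entire_form_comp F) auto
    have "Ca g \<le> C" unfolding C_def
      using member_le_sum[of g G Ca] g G Ca by auto
    have "?M ^ \<delta> g * ?M ^ (K - \<delta> g) = ?M ^ K" using d by (simp flip: power_add)
    also have "\<dots> \<le> gauss_norm v r (form_comp g F * coeff (\<Phi> (a g)) (K - \<delta> g))"
      using g d by (simp add: t_def)
    also have "\<dots> = gauss_norm v r (form_comp g F) * gauss_norm v r (coeff (\<Phi> (a g)) (K - \<delta> g))"
      unfolding \<Phi>_def using r by (intro gauss_norm_mult entire_form_comp F gauss_norm_graded_part(2)) auto
    also have "\<dots> \<le> gauss_norm v r (form_comp g F) * (Ca g * ?M ^ (K - \<delta> g))"
      unfolding \<Phi>_def Ca_def using nonneg
      by (intro mult_left_mono gauss_norm_graded_part(1) F r) auto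
    also have "\<dots> \<le> gauss_norm v r (form_comp g F) * (C * ?M ^ (K - \<delta> g))"
      using \<open>Ca g \<le> C\<close> nonneg M by (intro mult_left_mono mult_right_mono) auto
    also have "\<dots> = (C * gauss_norm v r (form_comp g F)) * ?M ^ (K - \<delta> g)" by simp
    finally have "?M ^ \<delta> g \<le> C * gauss_norm v r (form_comp g F)"
      using M by (simp add: mult_le_cancel_right)
    then have "1 / C * ?M ^ \<delta> g \<le> gauss_norm v r (form_comp g F)"
      using C by (simp add: pos_divide_le_eq mult.commute)
    then show "\<exists>g\<in>T. \<exists>d. is_form d g \<and> 1 / C * ?M ^ d \<le> gauss_norm v r (form_comp g F)"
      using g G \<delta> by blast
  qed
qed

text \<open>The coordinate attaining the norm of the curve changes with r, but there are finitely
  many coordinates, so the least of their constants serves for every r.\<close>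

lemma forms_lower_bound:
  fixes v :: "'a::alg_closed_field \<Rightarrow> real" and F :: "'a fps ^ 'N::finite"
    and T :: "('a, 'N) mpoly set"
  assumes "nonarch_abs v" and F: "\<And>i. entire v (F $ i)"
    and T: "\<And>g. g \<in> T \<Longrightarrow> \<exists>d. is_form d g"
    and zeros: "\<And>x. (\<And>g. g \<in> T \<Longrightarrow> mpoly_subst (\<lambda>c. c) g x = 0) \<Longrightarrow> x = 0"
  shows "\<exists>c>0. \<forall>r>0. 0 < curve_norm v r F \<longrightarrow>
    (\<exists>g\<in>T. \<exists>d. is_form d g \<and> c * curve_norm v r F ^ d \<le> gauss_norm v r (form_comp g F))"
proof -
  have "\<exists>c>0. \<forall>r>0. gauss_norm v r (F $ k) = curve_norm v r F \<longrightarrow> 0 < curve_norm v r F \<longrightarrow>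
    (\<exists>g\<in>T. \<exists>d. is_form d g \<and> c * curve_norm v r F ^ d \<le> gauss_norm v r (form_comp g F))" for k
    using assms(1) F T
  proof (rule forms_lower_bound_at)
    fix x assume "\<And>g. g \<in> T \<Longrightarrow> mpoly_subst (\<lambda>c. c) g x = 0"
    then have "x = 0" by (rule zeros)
    then show "x $ k = 0" by simp
  qed
  then obtain c where c: "\<And>k. 0 < c k" and bound: "\<And>k r. 0 < r \<Longrightarrow>
      gauss_norm v r (F $ k) = curve_norm v r F \<Longrightarrow> 0 < curve_norm v r F \<Longrightarrow>
      \<exists>g\<in>T. \<exists>d. is_form d g \<and> c k * curve_norm v r F ^ d \<le> gauss_norm v r (form_comp g F)"
    by metis
  show ?thesis
  proof (intro exI[of _ "Min (range c)"] conjI allI impI)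
    show "0 < Min (range c)" using c by (subst Min_gr_iff) auto
    fix r :: real assume r: "0 < r" "0 < curve_norm v r F"
    have "curve_norm v r F \<in> range (\<lambda>i. gauss_norm v r (F $ i))"
      unfolding curve_norm_def by (intro Max_in) auto
    then obtain k where "gauss_norm v r (F $ k) = curve_norm v r F" by auto
    from bound[OF r(1) this r(2)] obtain g d where
      g: "g \<in> T" "is_form d g" "c k * curve_norm v r F ^ d \<le> gauss_norm v r (form_comp g F)" by blast
    have "Min (range c) * curve_norm v r F ^ d \<le> c k * curve_norm v r F ^ d"
      using r by (intro mult_right_mono Min_le) auto
    with g show "\<exists>g\<in>T. \<exists>d. is_form d g \<and>
        Min (range c) * curve_norm v r F ^ d \<le> gauss_norm v r (form_comp g F)"
      by (meson order_trans)
  qed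
qed


section \<open>The inequality\<close>

text \<open>The indices with u above B contain no subset of n + 1 elements, so there are at most n
  of them. Nonnegativity of L allows their number to be replaced by n.\<close>

lemma sum_le_few_large:
  fixes u :: "'i \<Rightarrow> real"
  assumes J: "finite J" and L: "\<And>j. j \<in> J \<Longrightarrow> u j \<le> L" "0 \<le> L" and "0 \<le> B"
    and small: "\<And>I. I \<subseteq> J \<Longrightarrow> card I = n + 1 \<Longrightarrow> \<exists>i\<in>I. u i \<le> B"
  shows "sum u J \<le> real n * L + real (card J) * B"
proof -
  define G where "G = {j \<in> J. B < u j}"
  have G: "finite G" "G \<subseteq> J" using J by (auto simp: G_def)
  have "card G \<le> n"
  proof (rule ccontr)
    assume "\<not> card G \<le> n"
    then have "n + 1 \<le> card G" by simp
    then obtain I where I: "I \<subseteq> G" "card I = n + 1" by (rule obtain_subset_with_card_n) blast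
    then obtain i where "i \<in> I" "u i \<le> B" using small G by blast
    then show False using I by (auto simp: G_def)
  qed
  have "sum u J = sum u (J - G) + sum u G" using J G by (intro sum.subset_diff)
  moreover have "sum u G \<le> real (card G) * L" using L G by (intro sum_bounded_above) auto
  moreover have "real (card G) * L \<le> real n * L" using \<open>card G \<le> n\<close> L by (intro mult_right_mono) auto
  moreover have "sum u (J - G) \<le> real (card (J - G)) * B"
    by (intro sum_bounded_above) (auto simp: G_def)
  moreover have "real (card (J - G)) * B \<le> real (card J) * B"
    using J \<open>0 \<le> B\<close> by (intro mult_right_mono) (auto intro: card_mono)
  ultimately show ?thesis by linarith
qed

theorem mainTheorem1:
  fixes v :: "'a::alg_closed_field \<Rightarrow> real"
    and X :: "('a, 'N::finite) ppoint set"
    and n q :: nat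
    and d :: "nat \<Rightarrow> nat"
    and Q :: "nat \<Rightarrow> ('a, 'N) mpoly"
    and f :: "'a \<Rightarrow> ('a, 'N) ppoint"
    and F :: "'a fps ^ 'N"
  assumes "nonarch_abs v" and "abs_complete v"
    and "projective_variety X" and "proj_dim X = enat n" and "1 \<le> n"
    and "\<And>j. j \<in> {1..q} \<Longrightarrow> hypersurface_form (d j) (Q j)"
    and "in_general_position n X q Q"
    and "reduced_representation v F f" and "nonconstant_representation F"
    and "range f \<subseteq> X"
    and "\<And>j. j \<in> {1..q} \<Longrightarrow> \<not> range f \<subseteq> hypersurface (Q j)"
  shows "\<forall>r0>0. \<exists>C. \<forall>r\<ge>r0.
    (\<Sum>j=1..q. proximity v F (d j) (Q j) r / real (d j)) \<le> real n * characteristic v F r + C"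
proof (intro allI impI)
  fix r0 :: real assume r0: "0 < r0"
  interpret nonarch_field v by standard (rule assms)
  obtain S where S: "\<And>P. P \<in> S \<Longrightarrow> \<exists>d. is_form d P" and X: "X = proj_zeros S"
    using assms(3) unfolding projective_variety_def proj_closed_def by blast
  have F: "entire v (F $ i)" for i using assms(8) by (auto simp: reduced_representation_def)
  define y where "y = (\<lambda>z. \<chi> i. fps_value v (F $ i) z)"
  have fy: "f z = proj_point (y z)" for z
    using assms(8) by (auto simp: reduced_representation_def y_def)
  have Qform: "is_form (d j) (Q j)" "Q j \<noteq> 0" "1 \<le> d j" if "j \<in> {1..q}" for j
    using assms(6)[OF that] by (auto simp: hypersurface_form_def)
  have comp_value: "fps_value v (form_comp P F) z = mpoly_subst (\<lambda>c. c) P (y z)" for P z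
    by (intro fps_value_eq fps_sums_form_comp) (simp add: y_def fps_sums_value F)
  have zero_value: "fps_value v 0 z = 0" for z
    using fps_value_eq[OF fps_sums_const[of 0 z]] by simp
  \<comment> \<open>The curve lies in X, so this composition vanishes at every point; the identity
    theorem turns that into vanishing as a power series, hence Gauss norm 0.\<close>
  have SF: "form_comp P F = 0" if P: "P \<in> S" for P
  proof (rule entire_eq_zero[OF assms(1) entire_form_comp[OF F]])
    fix z
    obtain e where "is_form e P" using S[OF P] by blast
    moreover have "vanishes_at P (f z)" using assms(10) P by (auto simp: X proj_zeros_def)
    ultimately show "fps_value v (form_comp P F) z = 0"
      by (simp add: comp_value fy vanishes_at_proj_point)
  qed
  have QF: "form_comp (Q j) F \<noteq> 0" if j: "j \<in> {1..q}" for j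
  proof
    assume zero: "form_comp (Q j) F = 0"
    have "vanishes_at (Q j) (f z)" for z
      using comp_value[of "Q j" z] Qform(1)[OF j] by (simp add: zero zero_value fy vanishes_at_proj_point)
    then have "range f \<subseteq> hypersurface (Q j)"
      using assms(10) by (auto simp: hypersurface_def proj_zeros_def X)
    then show False using assms(11)[OF j] by blast
  qed
  let ?M = "\<lambda>r. curve_norm v r F" and ?G = "\<lambda>j r. gauss_norm v r (form_comp (Q j) F)"
  have Gpos: "0 < ?G j r" if "j \<in> {1..q}" "0 < r" for j r
    using that QF by (intro gauss_norm_pos entire_form_comp F)
  \<comment> \<open>The components have no common zero, so one of them is nonzero at 0 and therefore
    nonzero as a series.\<close>
  have Mpos: "0 < ?M r" if "0 < r" for r
  proof -
    obtain i where "fps_value v (F $ i) 0 \<noteq> 0"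
      using assms(8) unfolding reduced_representation_def by blast
    then have "F $ i \<noteq> 0" using zero_value by metis
    then have "0 < gauss_norm v r (F $ i)" using that F by (intro gauss_norm_pos)
    also have "\<dots> \<le> ?M r" by (rule curve_norm_ge)
    finally show ?thesis .
  qed
  have Mmono: "?M r0 \<le> ?M r" if "r0 \<le> r" for r
    unfolding curve_norm_def
  proof (rule Max.boundedI)
    fix x assume "x \<in> range (\<lambda>i. gauss_norm v r0 (F $ i))"
    then obtain i where "x = gauss_norm v r0 (F $ i)" by blast
    also have "\<dots> \<le> gauss_norm v r (F $ i)" using r0 that F by (intro gauss_norm_mono) auto
    also have "\<dots> \<le> Max (range (\<lambda>i. gauss_norm v r (F $ i)))" by (intro Max_ge) auto
    finally show "x \<le> Max (range (\<lambda>i. gauss_norm v r (F $ i)))" .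
  qed auto
  define u where "u = (\<lambda>r j. proximity v F (d j) (Q j) r / real (d j))"

  have "\<exists>B. \<forall>r>0. \<exists>i\<in>I. u r i \<le> B" if I: "I \<subseteq> {1..q}" "card I = n + 1" for I
  proof -
    \<comment> \<open>A nonzero common zero would represent a point of X on all the n + 1
      hypersurfaces indexed by I.\<close>
    have "x = 0" if x: "\<And>g. g \<in> S \<union> Q ` I \<Longrightarrow> mpoly_subst (\<lambda>c. c) g x = 0" for x
    proof (rule ccontr)
      assume "x \<noteq> 0"
      then have "proj_point x \<in> proj_space" by (simp add: proj_space_def)
      moreover have "vanishes_at P (proj_point x)" if "P \<in> S" for P
        using S[OF that] x that by (auto simp: vanishes_at_proj_point)
      ultimately have "proj_point x \<in> X" by (simp add: X proj_zeros_def)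
      moreover have "\<forall>i\<in>I. vanishes_at (Q i) (proj_point x)"
        using x I Qform(1) vanishes_at_proj_point by blast
      ultimately show False
        using assms(7) I unfolding in_general_position_def by blast
    qed
    moreover have "\<exists>e. is_form e g" if "g \<in> S \<union> Q ` I" for g using that S Qform I by blast
    ultimately obtain c where c: "0 < c" and bound: "\<And>r. 0 < r \<Longrightarrow> 0 < ?M r \<Longrightarrow>
        \<exists>g\<in>S \<union> Q ` I. \<exists>e. is_form e g \<and> c * ?M r ^ e \<le> gauss_norm v r (form_comp g F)"
      using forms_lower_bound[OF assms(1) F, of "S \<union> Q ` I"] by blast
    \<comment> \<open>The absolute value makes the bound nonnegative, so that dividing the proximity
      by a degree of at least 1 preserves it.\<close>
    have "\<exists>i\<in>I. u r i \<le> \<bar>ln (1 / c)\<bar>" if r: "0 < r" for r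
    proof -
      from bound[OF r Mpos[OF r]] obtain g e where
        g: "g \<in> S \<union> Q ` I" "is_form e g" "c * ?M r ^ e \<le> gauss_norm v r (form_comp g F)" by blast
      have "0 < c * ?M r ^ e" using c Mpos[OF r] by simp
      \<comment> \<open>The form found has a composition of positive norm, whereas forms of S
        compose to 0.\<close>
      then have "g \<notin> S" using g(3) SF[of g] by (auto simp: gauss_norm_zero)
      then obtain i where i: "i \<in> I" "g = Q i" using g by blast
      then have iq: "i \<in> {1..q}" using I by blast
      then have "e = d i" using is_form_unique[OF g(2), of "d i"] Qform(1,2)[OF iq] i(2) by simp
      then have le: "c * ?M r ^ d i \<le> ?G i r" using g i by simp
      have "?M r ^ d i / ?G i r \<le> 1 / c"
        using le c Gpos[OF iq r] by (simp add: field_simps)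
      then have "proximity v F (d i) (Q i) r \<le> ln (1 / c)"
        unfolding proximity_def using Gpos[OF iq r] Mpos[OF r] by (intro ln_mono) auto
      then have "proximity v F (d i) (Q i) r \<le> \<bar>ln (1 / c)\<bar>" by linarith
      also have "\<dots> \<le> \<bar>ln (1 / c)\<bar> * real (d i)" using Qform(3)[OF iq] by (simp add: mult_le_cancel_left1)
      finally have "u r i \<le> \<bar>ln (1 / c)\<bar>"
        unfolding u_def using Qform(3)[OF iq] by (simp add: pos_divide_le_eq)
      with i show ?thesis by blast
    qed
    then show ?thesis by blast
  qed
  then obtain b where b: "\<And>I r. I \<subseteq> {1..q} \<Longrightarrow> card I = n + 1 \<Longrightarrow> 0 < r \<Longrightarrow> \<exists>i\<in>I. u r i \<le> b I"
    by metis
  \<comment> \<open>Summing over all subsets gives one bound valid for every I at once.\<close>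
  define B where "B = (\<Sum>I\<in>Pow {1..q}. \<bar>b I\<bar>)"
  have bB: "b I \<le> B" if "I \<subseteq> {1..q}" for I
  proof -
    have "\<bar>b I\<bar> \<le> B" unfolding B_def using that by (intro member_le_sum[of I _ "\<lambda>I. \<bar>b I\<bar>"]) auto
    then show ?thesis by simp
  qed
  have B0: "0 \<le> B" unfolding B_def by (intro sum_nonneg) auto
  \<comment> \<open>Here r must stay away from 0. Gauss norms increase with r, so the values at r0
    bound -ln of the norm of each composition from above and T from below. The first sum thus
    absorbs the denominators of the proximity functions, and the last term makes T + A
    nonnegative.\<close>
  define A where "A = (\<Sum>j=1..q. \<bar>ln (?G j r0)\<bar>) + \<bar>ln (?M r0)\<bar>"
  show "\<exists>C. \<forall>r\<ge>r0. (\<Sum>j=1..q. proximity v F (d j) (Q j) r / real (d j)) \<le> real n * characteristic v F r + C"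
  proof (intro exI[of _ "real n * A + real q * B"] allI impI)
    fix r assume r: "r0 \<le> r"
    have rpos: "0 < r" using r r0 by simp
    let ?T = "characteristic v F r"
    have "ln (?M r0) \<le> ?T"
      unfolding characteristic_def using Mmono[OF r] Mpos[OF r0] by (intro ln_mono) auto
    moreover have "0 \<le> (\<Sum>j=1..q. \<bar>ln (?G j r0)\<bar>)" by (intro sum_nonneg) auto
    ultimately have L0: "0 \<le> ?T + A" unfolding A_def by linarith
    have L: "u r j \<le> ?T + A" if j: "j \<in> {1..q}" for j
    proof -
      have d: "1 \<le> real (d j)" using Qform(3)[OF j] by simp
      have "?G j r0 \<le> ?G j r" using r r0 F by (intro gauss_norm_mono entire_form_comp) auto
      then have "ln (?G j r0) \<le> ln (?G j r)" using Gpos[OF j r0] by (intro ln_mono) auto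
      then have "- ln (?G j r) \<le> \<bar>ln (?G j r0)\<bar>" by linarith
      also have "\<dots> \<le> \<bar>ln (?G j r0)\<bar> * real (d j)" using d by (simp add: mult_le_cancel_left1)
      finally have "- ln (?G j r) / real (d j) \<le> \<bar>ln (?G j r0)\<bar>"
        by (rule iffD2[OF pos_divide_le_eq, rotated]) (use d in linarith)
      also have "\<dots> \<le> (\<Sum>j=1..q. \<bar>ln (?G j r0)\<bar>)"
        using j by (intro member_le_sum[of j _ "\<lambda>j. \<bar>ln (?G j r0)\<bar>"]) auto
      also have "\<dots> \<le> A" by (simp add: A_def)
      finally have "- ln (?G j r) / real (d j) \<le> A" .
      moreover have "u r j = ?T + - ln (?G j r) / real (d j)"
        using d Mpos[OF rpos] Gpos[OF j rpos]
        by (simp add: u_def proximity_def characteristic_def ln_div ln_realpow diff_divide_distrib)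
      ultimately show ?thesis by linarith
    qed
    have "sum (u r) {1..q} \<le> real n * (?T + A) + real (card {1..q}) * B"
    proof (rule sum_le_few_large)
      show "\<exists>i\<in>I. u r i \<le> B" if "I \<subseteq> {1..q}" "card I = n + 1" for I
        using b[OF that rpos] bB[OF that(1)] by (meson order_trans)
    qed (use L L0 B0 in auto)
    then show "(\<Sum>j=1..q. proximity v F (d j) (Q j) r / real (d j)) \<le>
        real n * ?T + (real n * A + real q * B)"
      by (simp add: u_def algebra_simps)
  qed
qed

end
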